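(* Let $(M,g,J)$ be an almost Hermitian manifold. The mapping $\langle\cdot:\cdot\rangle:\Gamma(TM)\times\Gamma(TM)\to\Gamma(TM)$ given by $$\langle X:Y\rangle=-\tfrac12J\Big([X,JY]+[Y,JX]+\sharp\big(\mathcal{L}^a_X(JY)^\flat+\mathcal{L}^a_Y(JX)^\flat+\mathcal{L}^a_{JX}Y^\flat+\mathcal{L}^a_{JY}X^\flat\big)\Big)$$ is a symmetric bracket in the Lie algebroid $(TM,\mathrm{Id}_{TM},[\cdot,\cdot])$, where $[\cdot,\cdot]$ is the Lie bracket of vector fields on $M$ and $\mathcal{L}^a$ is the Lie derivative on $M$.
   Context: An almost Hermitian manifold $(M,g,J)$ is a $2n$-dimensional Riemannian manifold $(M,g)$ with an orthogonal almost complex structure $J:TM\to TM$. Here $X^\flat=g(X,\cdot)$ and $\sharp:T^*M\to TM$ is given by $g(\sharp(\omega),X)=\omega(X)$; the Lie derivative of a $1$-form is the usual one, $(\mathcal{L}^a_X\omega)(Y)=X(\omega(Y))-\omega([X,Y])$. A symmetric bracket in $(TM,\mathrm{Id}_{TM},[\cdot,\cdot])$ is an $\mathbb{R}$-bilinear symmetric map $\langle\cdot:\cdot\rangle:\Gamma(TM)\times\Gamma(TM)\to\Gamma(TM)$ with $\langle X:fY\rangle=f\langle X:Y\rangle+X(f)Y$ for $f\in C^\infty(M)$. *)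

theory Defs
  imports "HOL-Analysis.Analysis" "HOL-Library.Function_Algebras"
begin

section \<open>Pointwise vector space structure on functions\<close>

instantiation "fun" :: (type, real_vector) real_vector
begin

definition scaleR_fun :: "real \<Rightarrow> ('a \<Rightarrow> 'b) \<Rightarrow> 'a \<Rightarrow> 'b"
  where "scaleR_fun c f = (\<lambda>x. c *\<^sub>R f x)"

instance
  by standard (simp_all add: scaleR_fun_def plus_fun_def scaleR_add_right scaleR_add_left)

end

definition linear_on :: "'a::real_vector set \<Rightarrow> ('a \<Rightarrow> 'b::real_vector) \<Rightarrow> bool"
  where "linear_on S f \<longleftrightarrow>
    (\<forall>x\<in>S. \<forall>y\<in>S. f (x + y) = f x + f y) \<and> (\<forall>c. \<forall>x\<in>S. f (c *\<^sub>R x) = c *\<^sub>R f x)"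


section \<open>Smooth maps between Euclidean spaces\<close>

text \<open>Intended for open \<^term>\<open>S\<close> only.\<close>

primrec C_k_on :: "nat \<Rightarrow> 'a::real_normed_vector set \<Rightarrow> ('a \<Rightarrow> 'b::real_normed_vector) \<Rightarrow> bool"
  where
    "C_k_on 0 S f \<longleftrightarrow> continuous_on S f"
  | "C_k_on (Suc k) S f \<longleftrightarrow>
      (\<forall>x\<in>S. f differentiable (at x)) \<and> (\<forall>v. C_k_on k S (\<lambda>x. frechet_derivative f (at x) v))"

definition smooth_on :: "'a::real_normed_vector set \<Rightarrow> ('a \<Rightarrow> 'b::real_normed_vector) \<Rightarrow> bool"
  where "smooth_on S f \<longleftrightarrow> (\<forall>k. C_k_on k S f)"


section \<open>Smooth manifolds\<close>

text \<open>
  The manifold is the whole type \<^typ>\<open>'m\<close>, modelled on the Euclidean space \<^typ>\<open>'e\<close>. A chart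
  is a pair of its domain and the coordinate map (whose values outside the domain are irrelevant).
  The atlas need not be maximal.
\<close>

type_synonym ('m, 'e) chart = "'m set \<times> ('m \<Rightarrow> 'e)"

locale smooth_manifold =
  fixes A :: "('m::{t2_space, second_countable_topology}, 'e::euclidean_space) chart set"
  assumes chart: "(U, \<phi>) \<in> A \<Longrightarrow>
      open U \<and> open (\<phi> ` U) \<and> homeomorphism U (\<phi> ` U) \<phi> (inv_into U \<phi>)"
    and covering: "(\<Union>(U, \<phi>)\<in>A. U) = UNIV"
    and compatible: "(U, \<phi>) \<in> A \<Longrightarrow> (V, \<psi>) \<in> A \<Longrightarrow>
      smooth_on (\<phi> ` (U \<inter> V)) (\<psi> \<circ> inv_into U \<phi>)"

definition smooth_functions ::
    "('m::topological_space, 'e::euclidean_space) chart set \<Rightarrow> ('m \<Rightarrow> real) set"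
  where "smooth_functions A = {f. \<forall>(U, \<phi>)\<in>A. smooth_on (\<phi> ` U) (f \<circ> inv_into U \<phi>)}"


section \<open>Vector fields\<close>

text \<open>
  Tangent vectors at \<^term>\<open>p\<close> are the derivations at \<^term>\<open>p\<close> of the algebra of smooth functions.
  Being total functions in HOL, they are normalised to vanish on non-smooth arguments, so that
  equality of tangent vectors is equality of derivations.
\<close>

type_synonym 'm tangent = "('m \<Rightarrow> real) \<Rightarrow> real"
type_synonym 'm field = "'m \<Rightarrow> 'm tangent"

definition tangent_space ::
    "('m::topological_space, 'e::euclidean_space) chart set \<Rightarrow> 'm \<Rightarrow> 'm tangent set"
  where "tangent_space A p = {v. linear_on (smooth_functions A) v
    \<and> (\<forall>f\<in>smooth_functions A. \<forall>h\<in>smooth_functions A. v (f * h) = f p * v h + h p * v f)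
    \<and> (\<forall>f. f \<notin> smooth_functions A \<longrightarrow> v f = 0)}"

definition field_deriv :: "'m field \<Rightarrow> ('m \<Rightarrow> real) \<Rightarrow> 'm \<Rightarrow> real"
  where "field_deriv X f = (\<lambda>p. X p f)"

definition vector_fields ::
    "('m::topological_space, 'e::euclidean_space) chart set \<Rightarrow> 'm field set"
  where "vector_fields A = {X. (\<forall>p. X p \<in> tangent_space A p)
    \<and> (\<forall>f\<in>smooth_functions A. field_deriv X f \<in> smooth_functions A)}"

definition fmult :: "('m \<Rightarrow> real) \<Rightarrow> 'm field \<Rightarrow> 'm field"
  where "fmult f X = (\<lambda>p. f p *\<^sub>R X p)"

definition lie_bracket :: "'m field \<Rightarrow> 'm field \<Rightarrow> 'm field"
  where "lie_bracket X Y = (\<lambda>p f. X p (field_deriv Y f) - Y p (field_deriv X f))"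


section \<open>One-forms\<close>

text \<open>
  Covectors at \<^term>\<open>p\<close> are linear functionals on the tangent space, normalised to vanish outside it.
\<close>

type_synonym 'm form = "'m \<Rightarrow> 'm tangent \<Rightarrow> real"

definition form_app :: "'m form \<Rightarrow> 'm field \<Rightarrow> 'm \<Rightarrow> real"
  where "form_app \<omega> X = (\<lambda>p. \<omega> p (X p))"

definition one_forms ::
    "('m::topological_space, 'e::euclidean_space) chart set \<Rightarrow> 'm form set"
  where "one_forms A = {\<omega>. (\<forall>p. linear_on (tangent_space A p) (\<omega> p)
      \<and> (\<forall>v. v \<notin> tangent_space A p \<longrightarrow> \<omega> p v = 0))
    \<and> (\<forall>X\<in>vector_fields A. form_app \<omega> X \<in> smooth_functions A)}"

definition lie_deriv ::
    "('m::topological_space, 'e::euclidean_space) chart set \<Rightarrow> 'm field \<Rightarrow> 'm form \<Rightarrow> 'm form"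
  where "lie_deriv A X \<omega> = (THE \<eta>. \<eta> \<in> one_forms A \<and> (\<forall>Y\<in>vector_fields A.
    form_app \<eta> Y = field_deriv X (form_app \<omega> Y) - form_app \<omega> (lie_bracket X Y)))"


section \<open>Almost Hermitian manifolds\<close>

definition apply_endo :: "('m \<Rightarrow> 'm tangent \<Rightarrow> 'm tangent) \<Rightarrow> 'm field \<Rightarrow> 'm field"
  where "apply_endo J X = (\<lambda>p. J p (X p))"

locale riemannian_manifold = smooth_manifold A
  for A :: "('m::{t2_space, second_countable_topology}, 'e::euclidean_space) chart set" +
  fixes g :: "'m \<Rightarrow> 'm tangent \<Rightarrow> 'm tangent \<Rightarrow> real"
  assumes metric_linear: "v \<in> tangent_space A p \<Longrightarrow> linear_on (tangent_space A p) (g p v)"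
    and metric_sym: "v \<in> tangent_space A p \<Longrightarrow> w \<in> tangent_space A p \<Longrightarrow> g p v w = g p w v"
    and metric_pos: "v \<in> tangent_space A p \<Longrightarrow> v \<noteq> 0 \<Longrightarrow> g p v v > 0"
    and metric_smooth: "X \<in> vector_fields A \<Longrightarrow> Y \<in> vector_fields A \<Longrightarrow>
      (\<lambda>p. g p (X p) (Y p)) \<in> smooth_functions A"

locale almost_hermitian_manifold = riemannian_manifold A g
  for A :: "('m::{t2_space, second_countable_topology}, 'e::euclidean_space) chart set"
    and g :: "'m \<Rightarrow> 'm tangent \<Rightarrow> 'm tangent \<Rightarrow> real" +
  fixes J :: "'m \<Rightarrow> 'm tangent \<Rightarrow> 'm tangent"
    and n :: nat
  assumes dimension: "DIM('e) = 2 * n"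
    and J_tangent: "v \<in> tangent_space A p \<Longrightarrow> J p v \<in> tangent_space A p"
    and J_linear: "linear_on (tangent_space A p) (J p)"
    and J_smooth: "X \<in> vector_fields A \<Longrightarrow> apply_endo J X \<in> vector_fields A"
    and J_square: "v \<in> tangent_space A p \<Longrightarrow> J p (J p v) = - v"
    and J_orthogonal: "v \<in> tangent_space A p \<Longrightarrow> w \<in> tangent_space A p \<Longrightarrow>
      g p (J p v) (J p w) = g p v w"

definition flat ::
    "('m::topological_space, 'e::euclidean_space) chart set \<Rightarrow>
     ('m \<Rightarrow> 'm tangent \<Rightarrow> 'm tangent \<Rightarrow> real) \<Rightarrow> 'm field \<Rightarrow> 'm form"
  where "flat A g X = (\<lambda>p v. if v \<in> tangent_space A p then g p (X p) v else 0)"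

definition sharp ::
    "('m::topological_space, 'e::euclidean_space) chart set \<Rightarrow>
     ('m \<Rightarrow> 'm tangent \<Rightarrow> 'm tangent \<Rightarrow> real) \<Rightarrow> 'm form \<Rightarrow> 'm field"
  where "sharp A g \<omega> = (\<lambda>p. THE v. v \<in> tangent_space A p \<and>
    (\<forall>w\<in>tangent_space A p. g p v w = \<omega> p w))"


section \<open>Symmetric brackets\<close>

text \<open>Symmetric brackets in the Lie algebroid of the tangent bundle, whose anchor is the identity.\<close>

definition symmetric_bracket ::
    "('m::topological_space, 'e::euclidean_space) chart set \<Rightarrow>
     ('m field \<Rightarrow> 'm field \<Rightarrow> 'm field) \<Rightarrow> bool"
  where "symmetric_bracket A B \<longleftrightarrow>
    (\<forall>X\<in>vector_fields A. \<forall>Y\<in>vector_fields A. B X Y \<in> vector_fields A) \<and>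
    (\<forall>X\<in>vector_fields A. linear_on (vector_fields A) (B X)) \<and>
    (\<forall>Y\<in>vector_fields A. linear_on (vector_fields A) (\<lambda>X. B X Y)) \<and>
    (\<forall>X\<in>vector_fields A. \<forall>Y\<in>vector_fields A. B X Y = B Y X) \<and>
    (\<forall>X\<in>vector_fields A. \<forall>Y\<in>vector_fields A. \<forall>f\<in>smooth_functions A.
      B X (fmult f Y) = fmult f (B X Y) + fmult (field_deriv X f) Y)"

definition hermitian_bracket ::
    "('m::topological_space, 'e::euclidean_space) chart set \<Rightarrow>
     ('m \<Rightarrow> 'm tangent \<Rightarrow> 'm tangent \<Rightarrow> real) \<Rightarrow> ('m \<Rightarrow> 'm tangent \<Rightarrow> 'm tangent) \<Rightarrow>
     'm field \<Rightarrow> 'm field \<Rightarrow> 'm field"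
  where "hermitian_bracket A g J X Y =
    (let JX = apply_endo J X; JY = apply_endo J Y in
      (- 1 / 2) *\<^sub>R apply_endo J
        (lie_bracket X JY + lie_bracket Y JX +
         sharp A g
           (lie_deriv A X (flat A g JY) + lie_deriv A Y (flat A g JX) +
            lie_deriv A JX (flat A g Y) + lie_deriv A JY (flat A g X))))"

end

theory Submission
  imports Defs
begin

text \<open>
  Algebraically the theorem is a short computation. Replace \<open>Y\<close> by \<open>fY\<close> in the bracket. The two Lie
  brackets contribute the extra terms \<open>X(f) JY\<close> and \<open>-JX(f) Y\<close>. For the Lie derivatives one has
  \<open>\<L>\<^sub>X(f\<omega>) = f \<L>\<^sub>X\<omega> + X(f) \<omega>\<close> and \<open>\<L>\<^sub>f\<^sub>X\<omega> = f \<L>\<^sub>X\<omega> + \<omega>(X) df\<close>, so that after raising the index they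
  contribute \<open>X(f) JY + JX(f) Y\<close> and \<open>g(JX, Y) + g(X, JY)\<close> times the gradient of \<open>f\<close>. As \<open>J\<close> is
  orthogonal with \<open>J\<^sup>2 = -1\<close>, it is skew-adjoint and the gradient terms cancel. What remains is
  \<open>-1/2 J(2 X(f) JY) = X(f) Y\<close>. Symmetry is visible in the formula, and linearity in one argument
  therefore suffices (\<open>sharp_form_part_fmult\<close>, \<open>hermitian_bracket_fmult\<close>).

  The substance lies in showing that the operations in the formula are what they should be. Both
  \<^const>\<open>lie_deriv\<close> and \<^const>\<open>sharp\<close> are definite descriptions, whose existence, uniqueness and
  smoothness rest on three facts about smooth manifolds with tangent vectors taken as derivations.

  \<^item> Every point has a neighbourhood with a smooth frame made of global vector fields
    (\<open>local_frame\<close>). That the coordinate fields span all derivations is Hadamard's lemma; bump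
    functions make derivations local and coordinate fields global.

  \<^item> A map from vector fields to functions that is linear over the smooth functions is given by a
    one-form (\<open>function_linear_is_pointwise\<close>, \<open>tensor_form\<close>). This yields Lie derivatives of forms.

  \<^item> Gram--Schmidt orthogonalisation of a local frame shows that the vector representing a smooth
    one-form depends smoothly on the point (\<open>gram_schmidt\<close>, \<open>sharp_vector_field\<close>).
\<close>


section \<open>Calculus of smooth maps\<close>

lemma C_k_on_cong:
  assumes "C_k_on k S f" and "open S" and "\<And>x. x \<in> S \<Longrightarrow> f x = g x"
  shows "C_k_on k S g"
  using assms(1,3)
proof (induction k arbitrary: f g)
  case 0
  then show ?case
    using continuous_on_cong[of S S f g] by simp
next
  case (Suc k)
  have df: "(f has_derivative frechet_derivative f (at x)) (at x)" if "x \<in> S" for x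
    using Suc.prems(1) that by (simp add: frechet_derivative_works)
  have dg: "(g has_derivative frechet_derivative f (at x)) (at x)" if "x \<in> S" for x
    using has_derivative_transform_within_open[OF df[OF that] \<open>open S\<close> that] Suc.prems(2) by auto
  have "frechet_derivative f (at x) = frechet_derivative g (at x)" if "x \<in> S" for x
    using dg[OF that] by (rule frechet_derivative_at)
  then have "frechet_derivative f (at x) v = frechet_derivative g (at x) v" if "x \<in> S" for x v
    using that by metis
  moreover have "C_k_on k S (\<lambda>x. frechet_derivative f (at x) v)" for v
    using Suc.prems(1) by simp
  ultimately have "C_k_on k S (\<lambda>x. frechet_derivative g (at x) v)" for v
    by (rule Suc.IH[rotated])
  moreover have "g differentiable at x" if "x \<in> S" for x
    using dg[OF that] by (rule differentiableI)
  ultimately show ?case by simp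
qed

text \<open>The derivative may be given by any formula valid on the open set, so the closure properties
  below never mention \<^const>\<open>frechet_derivative\<close> of a compound expression.\<close>

lemma C_k_on_Suc_if_has_derivative:
  assumes "open S" and "\<And>x. x \<in> S \<Longrightarrow> (f has_derivative f' x) (at x)"
    and "\<And>v. C_k_on k S (\<lambda>x. f' x v)"
  shows "C_k_on (Suc k) S f"
  unfolding C_k_on.simps
proof (intro conjI ballI allI)
  show "f differentiable at x" if "x \<in> S" for x
    using assms(2)[OF that] by (rule differentiableI)
  show "C_k_on k S (\<lambda>x. frechet_derivative f (at x) v)" for v
  proof (rule C_k_on_cong[OF assms(3)[of v] \<open>open S\<close>])
    show "f' x v = frechet_derivative f (at x) v" if "x \<in> S" for x
      using frechet_derivative_at[OF assms(2)[OF that]] by simp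
  qed
qed

lemma C_k_on_has_derivative:
  "C_k_on (Suc k) S f \<Longrightarrow> x \<in> S \<Longrightarrow> (f has_derivative frechet_derivative f (at x)) (at x)"
  by (simp add: frechet_derivative_works)

lemma C_k_on_derivative:
  "C_k_on (Suc k) S f \<Longrightarrow> C_k_on k S (\<lambda>x. frechet_derivative f (at x) v)"
  by simp

lemma C_k_on_Suc_imp_C_k_on: "C_k_on (Suc k) S f \<Longrightarrow> C_k_on k S f"
proof (induction k arbitrary: f)
  case 0
  then show ?case
    by (simp add: continuous_at_imp_continuous_on differentiable_imp_continuous_within)
next
  case (Suc k)
  then show ?case by (metis C_k_on.simps(2))
qed

lemma C_k_on_imp_continuous_on: "C_k_on k S f \<Longrightarrow> continuous_on S f"
  by (induction k) (use C_k_on_Suc_imp_C_k_on in \<open>auto\<close>)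

lemma C_k_on_subset: "C_k_on k S f \<Longrightarrow> T \<subseteq> S \<Longrightarrow> C_k_on k T f"
  by (induction k arbitrary: f) (auto intro: continuous_on_subset)

lemma C_k_on_locally:
  assumes "\<And>x. x \<in> S \<Longrightarrow> \<exists>T. open T \<and> x \<in> T \<and> C_k_on k T f"
  shows "C_k_on k S f"
  using assms
proof (induction k arbitrary: f)
  case 0
  then show ?case
    by (auto simp: continuous_on_eq_continuous_within)
      (metis at_within_open continuous_at_imp_continuous_within continuous_on_eq_continuous_within)
next
  case (Suc k)
  show ?case
    unfolding C_k_on.simps
  proof (intro conjI ballI allI)
    show "f differentiable at x" if "x \<in> S" for x
      using Suc.prems[OF that] by auto
    show "C_k_on k S (\<lambda>x. frechet_derivative f (at x) v)" for v
    proof (rule Suc.IH)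
      fix x assume "x \<in> S"
      from Suc.prems[OF this] obtain T where "open T" "x \<in> T" "C_k_on (Suc k) T f" by blast
      then show "\<exists>T. open T \<and> x \<in> T \<and> C_k_on k T (\<lambda>x. frechet_derivative f (at x) v)"
        by (intro exI[of _ T] conjI C_k_on_derivative)
    qed
  qed
qed

lemma C_k_on_const: "C_k_on k S (\<lambda>x. c)"
proof (induction k arbitrary: c)
  case (Suc k)
  have "frechet_derivative (\<lambda>x. c) (at x) = (\<lambda>v. 0)" for x :: 'a and c :: 'b
    using frechet_derivative_at[OF has_derivative_const[of c "at x"]] by simp
  then show ?case using Suc by simp
qed simp

lemma C_k_on_bounded_linear:
  assumes "bounded_linear L" and "open S"
  shows "C_k_on k S L"
proof (cases k)
  case 0
  then show ?thesis
    using assms by (simp add: linear_continuous_on)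
next
  case (Suc m)
  have "(L has_derivative L) (at x)" for x
    using assms(1) by (rule bounded_linear_imp_has_derivative)
  then show ?thesis
    unfolding Suc by (rule C_k_on_Suc_if_has_derivative[OF \<open>open S\<close>]) (rule C_k_on_const)
qed

lemma C_k_on_add:
  assumes "C_k_on k S f" and "C_k_on k S g" and "open S"
  shows "C_k_on k S (\<lambda>x. f x + g x)"
  using assms(1,2)
proof (induction k arbitrary: f g)
  case 0
  then show ?case by (simp add: continuous_on_add)
next
  case (Suc k)
  show ?case
    by (rule C_k_on_Suc_if_has_derivative[OF \<open>open S\<close> has_derivative_add[OF
          C_k_on_has_derivative[OF Suc.prems(1)] C_k_on_has_derivative[OF Suc.prems(2)]]],
        assumption, assumption)
      (intro Suc.IH
        C_k_on_derivative[OF Suc.prems(1)] C_k_on_derivative[OF Suc.prems(2)])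
qed

lemma C_k_on_sum:
  assumes "\<And>i. i \<in> I \<Longrightarrow> C_k_on k S (f i)" and "open S"
  shows "C_k_on k S (\<lambda>x. \<Sum>i\<in>I. f i x)"
  using assms(1) by (induction I rule: infinite_finite_induct)
    (auto intro: C_k_on_const C_k_on_add[OF _ _ \<open>open S\<close>])

lemma (in bounded_bilinear) C_k_on:
  assumes "C_k_on k S f" and "C_k_on k S g" and "open S"
  shows "C_k_on k S (\<lambda>x. prod (f x) (g x))"
  using assms(1,2)
proof (induction k arbitrary: f g)
  case 0
  then show ?case by (simp add: continuous_on)
next
  case (Suc k)
  show ?case
    by (rule C_k_on_Suc_if_has_derivative[OF \<open>open S\<close> FDERIV[OF
          C_k_on_has_derivative[OF Suc.prems(1)] C_k_on_has_derivative[OF Suc.prems(2)]]],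
        assumption, assumption)
      (intro Suc.IH C_k_on_add[OF _ _ \<open>open S\<close>]
        C_k_on_derivative[OF Suc.prems(1)] C_k_on_derivative[OF Suc.prems(2)]
        C_k_on_Suc_imp_C_k_on[OF Suc.prems(1)] C_k_on_Suc_imp_C_k_on[OF Suc.prems(2)])
qed

lemmas C_k_on_mult = bounded_bilinear.C_k_on[OF bounded_bilinear_mult]
lemmas C_k_on_scaleR = bounded_bilinear.C_k_on[OF bounded_bilinear_scaleR]
lemmas C_k_on_inner = bounded_bilinear.C_k_on[OF bounded_bilinear_inner]

text \<open>The derivative of the reciprocal is a product in which the reciprocal itself occurs, so
  \<open>k\<close>-fold differentiability reproduces itself.\<close>

lemma C_k_on_inverse:
  fixes f :: "'a::real_normed_vector \<Rightarrow> real"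
  assumes "C_k_on k S f" and "open S" and nz: "\<And>x. x \<in> S \<Longrightarrow> f x \<noteq> 0"
  shows "C_k_on k S (\<lambda>x. inverse (f x))"
  using assms(1)
proof (induction k)
  case 0
  then show ?case using nz by (simp add: continuous_on_inverse)
next
  case (Suc k)
  note IH = Suc.IH[OF C_k_on_Suc_imp_C_k_on[OF Suc.prems]]
  show ?case
  proof (rule C_k_on_Suc_if_has_derivative[OF \<open>open S\<close>])
    show "((\<lambda>x. inverse (f x)) has_derivative
        (\<lambda>v. (-1) * (inverse (f x) * frechet_derivative f (at x) v * inverse (f x)))) (at x)"
      if "x \<in> S" for x
      using Deriv.has_derivative_inverse[OF nz[OF that] C_k_on_has_derivative[OF Suc.prems that]] by simp
    show "C_k_on k S (\<lambda>x. (-1) * (inverse (f x) * frechet_derivative f (at x) v * inverse (f x)))"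
      for v
      by (intro C_k_on_mult[OF _ _ \<open>open S\<close>] C_k_on_const IH C_k_on_derivative[OF Suc.prems])
  qed
qed

text \<open>The chain rule expresses the derivative of a composition through the derivatives of the outer
  map in the finitely many basis directions, which keeps the induction within
  \<^const>\<open>C_k_on\<close>.\<close>

lemma C_k_on_compose:
  fixes f :: "'a::real_normed_vector \<Rightarrow> 'b::euclidean_space" and g :: "'b \<Rightarrow> 'c::real_normed_vector"
  assumes "C_k_on k S f" and "C_k_on k T g" and "open S" and sub: "f ` S \<subseteq> T"
  shows "C_k_on k S (\<lambda>x. g (f x))"
  using assms(1,2)
proof (induction k arbitrary: g)
  case 0
  then show ?case using sub by (auto intro: continuous_on_compose2)
next
  case (Suc k)
  show ?case
  proof (rule C_k_on_Suc_if_has_derivative[OF \<open>open S\<close>])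
    fix x assume x: "x \<in> S"
    let ?Df = "frechet_derivative f (at x)" and ?Dg = "frechet_derivative g (at (f x))"
    have g: "(g has_derivative ?Dg) (at (f x))"
      by (rule C_k_on_has_derivative[OF Suc.prems(2)]) (use sub x in auto)
    then have lin: "linear ?Dg"
      by (rule has_derivative_linear)
    have "?Dg (?Df v) = (\<Sum>b\<in>Basis. (?Df v \<bullet> b) *\<^sub>R ?Dg b)" for v
      by (subst euclidean_representation[of "?Df v", symmetric])
        (simp add: linear_sum[OF lin] linear_scale[OF lin])
    then have "(\<lambda>v. ?Dg (?Df v)) = (\<lambda>v. \<Sum>b\<in>Basis. (?Df v \<bullet> b) *\<^sub>R ?Dg b)" by simp
    with has_derivative_compose[OF C_k_on_has_derivative[OF Suc.prems(1) x] g]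
    show "((\<lambda>x. g (f x)) has_derivative (\<lambda>v. \<Sum>b\<in>Basis. (?Df v \<bullet> b) *\<^sub>R ?Dg b)) (at x)"
      by simp
  next
    fix v
    show "C_k_on k S (\<lambda>x. \<Sum>b\<in>Basis. (frechet_derivative f (at x) v \<bullet> b) *\<^sub>R
        frechet_derivative g (at (f x)) b)"
      by (intro C_k_on_sum C_k_on_scaleR[OF _ _ \<open>open S\<close>] C_k_on_inner[OF _ _ \<open>open S\<close>] C_k_on_const
          C_k_on_derivative[OF Suc.prems(1)]
          Suc.IH[OF C_k_on_Suc_imp_C_k_on[OF Suc.prems(1)] C_k_on_derivative[OF Suc.prems(2)]]
          \<open>open S\<close>)
  qed
qed

lemma smooth_on_cong:
  "smooth_on S f \<Longrightarrow> open S \<Longrightarrow> (\<And>x. x \<in> S \<Longrightarrow> f x = g x) \<Longrightarrow> smooth_on S g"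
  unfolding smooth_on_def by (blast intro: C_k_on_cong)

lemma smooth_on_subset: "smooth_on S f \<Longrightarrow> T \<subseteq> S \<Longrightarrow> smooth_on T f"
  unfolding smooth_on_def by (blast intro: C_k_on_subset)

lemma smooth_on_locally:
  assumes "\<And>x. x \<in> S \<Longrightarrow> \<exists>T. open T \<and> x \<in> T \<and> smooth_on T f"
  shows "smooth_on S f"
  unfolding smooth_on_def
proof
  show "C_k_on k S f" for k
  proof (rule C_k_on_locally)
    fix x assume "x \<in> S"
    from assms[OF this] show "\<exists>T. open T \<and> x \<in> T \<and> C_k_on k T f"
      unfolding smooth_on_def by blast
  qed
qed

lemma smooth_on_imp_continuous_on: "smooth_on S f \<Longrightarrow> continuous_on S f"
  unfolding smooth_on_def by (blast intro: C_k_on_imp_continuous_on)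

lemma smooth_on_has_derivative:
  "smooth_on S f \<Longrightarrow> x \<in> S \<Longrightarrow> (f has_derivative frechet_derivative f (at x)) (at x)"
  unfolding smooth_on_def by (blast intro: C_k_on_has_derivative)

lemma smooth_on_derivative: "smooth_on S f \<Longrightarrow> smooth_on S (\<lambda>x. frechet_derivative f (at x) v)"
  unfolding smooth_on_def by (blast intro: C_k_on_derivative)

lemma smooth_on_const: "smooth_on S (\<lambda>x. c)"
  by (simp add: smooth_on_def C_k_on_const)

lemma smooth_on_bounded_linear: "bounded_linear L \<Longrightarrow> open S \<Longrightarrow> smooth_on S L"
  by (simp add: smooth_on_def C_k_on_bounded_linear)

lemma smooth_on_add:
  "smooth_on S f \<Longrightarrow> smooth_on S g \<Longrightarrow> open S \<Longrightarrow> smooth_on S (\<lambda>x. f x + g x)"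
  by (simp add: smooth_on_def C_k_on_add)

lemma smooth_on_mult:
  fixes f g :: "'a::real_normed_vector \<Rightarrow> real"
  shows "smooth_on S f \<Longrightarrow> smooth_on S g \<Longrightarrow> open S \<Longrightarrow> smooth_on S (\<lambda>x. f x * g x)"
  by (simp add: smooth_on_def C_k_on_mult)

lemma smooth_on_inner:
  "smooth_on S f \<Longrightarrow> smooth_on S g \<Longrightarrow> open S \<Longrightarrow> smooth_on S (\<lambda>x. f x \<bullet> g x)"
  by (simp add: smooth_on_def C_k_on_inner)

lemma smooth_on_inverse:
  fixes f :: "'a::real_normed_vector \<Rightarrow> real"
  shows "smooth_on S f \<Longrightarrow> open S \<Longrightarrow> (\<And>x. x \<in> S \<Longrightarrow> f x \<noteq> 0) \<Longrightarrow>
    smooth_on S (\<lambda>x. inverse (f x))"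
  by (simp add: smooth_on_def C_k_on_inverse)

lemma smooth_on_compose:
  fixes f :: "'a::real_normed_vector \<Rightarrow> 'b::euclidean_space"
  shows "smooth_on S f \<Longrightarrow> smooth_on T g \<Longrightarrow> open S \<Longrightarrow> f ` S \<subseteq> T \<Longrightarrow>
    smooth_on S (\<lambda>x. g (f x))"
  unfolding smooth_on_def by (blast intro: C_k_on_compose)


section \<open>A flat function and a plateau function\<close>

text \<open>The extra factor \<open>t\<^sup>-\<^sup>m\<close> makes this family closed under differentiation, up to linear
  combinations; the member of interest is \<open>m = 0\<close>.\<close>

definition flat_fun :: "nat \<Rightarrow> real \<Rightarrow> real"
  where "flat_fun m t = (if t > 0 then inverse t ^ m * exp (- inverse t) else 0)"

lemma flat_fun_nonneg: "flat_fun m t \<ge> 0"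
  by (simp add: flat_fun_def)

lemma flat_fun_pos: "t > 0 \<Longrightarrow> flat_fun m t > 0"
  by (simp add: flat_fun_def)

lemma flat_fun_zero: "t \<le> 0 \<Longrightarrow> flat_fun m t = 0"
  by (simp add: flat_fun_def)

text \<open>After substituting \<open>u = 1/t\<close> this says that the exponential beats every power.\<close>

lemma flat_fun_tendsto_0: "(flat_fun m \<longlongrightarrow> 0) (at 0)"
proof -
  have "((\<lambda>t. inverse t ^ m / exp (inverse t)) \<longlongrightarrow> (0::real)) (at_right 0)"
    by (rule filterlim_compose[OF tendsto_power_div_exp_0 filterlim_inverse_at_top_right])
  then have "(flat_fun m \<longlongrightarrow> 0) (at_right 0)"
    by (rule Lim_transform_eventually)
      (auto simp: eventually_at_filter flat_fun_def exp_minus field_simps)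
  moreover have "(flat_fun m \<longlongrightarrow> 0) (at_left 0)"
    by (rule tendsto_eventually) (auto simp: eventually_at_filter flat_fun_def)
  ultimately show ?thesis
    by (simp add: filterlim_split_at)
qed

lemma flat_fun_has_derivative:
  "(flat_fun m has_real_derivative (flat_fun (m + 2) t - real m * flat_fun (m + 1) t)) (at t)"
proof -
  consider "t > 0" | "t < 0" | "t = 0" by linarith
  then show ?thesis
  proof cases
    case 1
    have "((\<lambda>t. inverse t ^ m * exp (- inverse t)) has_real_derivative
        flat_fun (m + 2) t - real m * flat_fun (m + 1) t) (at t)"
    proof -
      have inv: "(inverse has_real_derivative - (inverse t * inverse t)) (at t)"
        using 1 DERIV_inverse[of t] by (simp add: numeral_2_eq_2)
      have "((\<lambda>t. inverse t ^ m) has_real_derivative - real m * inverse t ^ (m + 1)) (at t)"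
        by (rule DERIV_cong[OF DERIV_power[OF inv, of m]]) (cases m; simp add: algebra_simps)
      from DERIV_mult[OF this DERIV_fun_exp[OF DERIV_minus[OF inv]]]
      show ?thesis
        using 1 by (rule_tac DERIV_cong) (auto simp: flat_fun_def algebra_simps)
    qed
    then show ?thesis
      by (rule has_field_derivative_transform_within_open[where S = "{0<..}"])
        (use 1 in \<open>auto simp: flat_fun_def\<close>)
  next
    case 2
    have "((\<lambda>t. 0) has_real_derivative 0) (at t)" by simp
    then have "(flat_fun m has_real_derivative 0) (at t)"
      by (rule has_field_derivative_transform_within_open[where S = "{..<0}"])
        (use 2 in \<open>auto simp: flat_fun_def\<close>)
    then show ?thesis using 2 by (simp add: flat_fun_def)
  next
    case 3
    \<comment> \<open>The difference quotient at the origin is itself the next member of the family.\<close>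
    have "((\<lambda>h. (flat_fun m (0 + h) - flat_fun m 0) / h) \<longlongrightarrow> 0) (at 0)"
      by (rule Lim_transform_eventually[OF flat_fun_tendsto_0[of "m + 1"]])
        (auto simp: eventually_at_filter flat_fun_def field_simps)
    then show ?thesis using 3 by (simp add: DERIV_def flat_fun_zero)
  qed
qed

lemma C_k_on_flat_fun: "C_k_on k UNIV (flat_fun m)"
proof (induction k arbitrary: m)
  case 0
  show ?case
    using flat_fun_has_derivative by (auto intro!: DERIV_continuous_on)
next
  case (Suc k)
  show ?case
  proof (rule C_k_on_Suc_if_has_derivative[OF open_UNIV])
    show "(flat_fun m has_derivative
        (\<lambda>v. v * (flat_fun (m + 2) t + (- real m) * flat_fun (m + 1) t))) (at t)" for t
      by (rule has_derivative_eq_rhs[OF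
            flat_fun_has_derivative[of m t, unfolded has_field_derivative_def]])
        (simp add: fun_eq_iff algebra_simps)
    show "C_k_on k UNIV (\<lambda>t. v * (flat_fun (m + 2) t + (- real m) * flat_fun (m + 1) t))" for v
      by (intro C_k_on_mult C_k_on_add C_k_on_const Suc.IH open_UNIV)
  qed
qed

lemma smooth_on_flat_fun: "smooth_on UNIV (flat_fun m)"
  by (simp add: smooth_on_def C_k_on_flat_fun)

text \<open>A smooth step function, equal to 1 up to 1 and to 0 from 2 on: the two summands of the
  denominator never vanish together.\<close>

definition plateau :: "real \<Rightarrow> real"
  where "plateau t = flat_fun 0 (2 - t) * inverse (flat_fun 0 (2 - t) + flat_fun 0 (t - 1))"

lemma plateau_denominator_pos: "flat_fun 0 (2 - t) + flat_fun 0 (t - 1) > 0"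
proof (cases "t < 2")
  case True
  then show ?thesis by (intro add_pos_nonneg flat_fun_pos flat_fun_nonneg) simp
next
  case False
  then show ?thesis by (intro add_nonneg_pos flat_fun_pos flat_fun_nonneg) simp
qed

lemma plateau_eq_1: "t \<le> 1 \<Longrightarrow> plateau t = 1"
  using plateau_denominator_pos[of t] by (simp add: plateau_def flat_fun_zero[of "t - 1"])

lemma plateau_eq_0: "t \<ge> 2 \<Longrightarrow> plateau t = 0"
  by (simp add: plateau_def flat_fun_zero)

lemma smooth_on_plateau: "smooth_on UNIV plateau"
proof -
  have lin: "smooth_on UNIV (\<lambda>t::real. t)"
    by (rule smooth_on_bounded_linear[OF bounded_linear_ident open_UNIV])
  have minus: "smooth_on UNIV (\<lambda>t::real. 2 + (-1) * t)" "smooth_on UNIV (\<lambda>t::real. t + (-1))"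
    by (intro smooth_on_add smooth_on_mult smooth_on_const lin open_UNIV)+
  have "smooth_on UNIV (\<lambda>t. flat_fun 0 (2 + (-1) * t))" "smooth_on UNIV (\<lambda>t. flat_fun 0 (t + (-1)))"
    by (intro smooth_on_compose[OF minus(1) smooth_on_flat_fun]
        smooth_on_compose[OF minus(2) smooth_on_flat_fun]; simp)+
  then have s: "smooth_on UNIV (\<lambda>t. flat_fun 0 (2 - t))" "smooth_on UNIV (\<lambda>t. flat_fun 0 (t - 1))"
    by simp_all
  have "smooth_on UNIV
      (\<lambda>t. flat_fun 0 (2 - t) * inverse (flat_fun 0 (2 - t) + flat_fun 0 (t - 1)))"
    by (intro smooth_on_mult smooth_on_inverse smooth_on_add s open_UNIV)
      (use plateau_denominator_pos in \<open>simp add: less_imp_neq[symmetric]\<close>)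
  then show ?thesis
    by (simp add: plateau_def[abs_def])
qed


section \<open>Hadamard's lemma\<close>

text \<open>These weighted means along the segment from \<open>a\<close> to \<open>y\<close> are the coefficient functions in
  Hadamard's lemma for \<open>m = 0\<close>. The weight \<open>t ^ m\<close> is there because each differentiation under the
  integral sign produces one more factor \<open>t\<close>.\<close>

definition radial_mean :: "nat \<Rightarrow> 'e::euclidean_space \<Rightarrow> ('e \<Rightarrow> real) \<Rightarrow> 'e \<Rightarrow> real"
  where "radial_mean m a F y = integral (cbox 0 1) (\<lambda>t. t ^ m * F (a + t *\<^sub>R (y - a)))"

lemma radial_segment_in_ball:
  fixes a y :: "'a::real_normed_vector"
  assumes "y \<in> ball a r" and "t \<in> cbox 0 (1::real)"
  shows "a + t *\<^sub>R (y - a) \<in> ball a r"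
proof -
  have "dist a (a + t *\<^sub>R (y - a)) = t * dist a y"
    using assms(2) norm_scaleR[of t "y - a"] by (simp add: dist_norm norm_minus_commute[of a])
  also have "\<dots> \<le> dist a y"
    using assms(2) by (simp add: mult_left_le_one_le)
  finally show ?thesis using assms(1) by simp
qed

lemma continuous_on_radial:
  fixes F :: "'e::real_normed_vector \<Rightarrow> real"
  assumes "continuous_on (ball a r) F"
  shows "continuous_on (ball a r \<times> cbox 0 1) (\<lambda>(y, t::real). t ^ m * F (a + t *\<^sub>R (y - a)))"
proof -
  have "continuous_on (ball a r \<times> cbox 0 (1::real)) (\<lambda>z. F (a + snd z *\<^sub>R (fst z - a)))"
  proof (rule continuous_on_compose2[OF assms])
    show "continuous_on (ball a r \<times> cbox 0 (1::real)) (\<lambda>z. a + snd z *\<^sub>R (fst z - a))"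
      by (intro continuous_intros)
    show "(\<lambda>z. a + snd z *\<^sub>R (fst z - a)) ` (ball a r \<times> cbox 0 (1::real)) \<subseteq> ball a r"
      using radial_segment_in_ball[of _ a r] by force
  qed
  then show ?thesis
    by (auto simp: split_beta intro!: continuous_intros)
qed

lemma continuous_on_radial_segment:
  fixes F :: "'e::real_normed_vector \<Rightarrow> real"
  assumes "continuous_on (ball a r) F" and "y \<in> ball a r"
  shows "continuous_on (cbox 0 1) (\<lambda>t::real. t ^ m * F (a + t *\<^sub>R (y - a)))"
proof -
  have "continuous_on (cbox 0 (1::real)) (\<lambda>t. F (a + t *\<^sub>R (y - a)))"
  proof (rule continuous_on_compose2[OF assms(1)])
    show "continuous_on (cbox 0 (1::real)) (\<lambda>t. a + t *\<^sub>R (y - a))"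
      by (intro continuous_intros)
    show "(\<lambda>t. a + t *\<^sub>R (y - a)) ` cbox 0 (1::real) \<subseteq> ball a r"
      using radial_segment_in_ball[OF assms(2)] by blast
  qed
  then show ?thesis
    by (intro continuous_intros)
qed

text \<open>Differentiation under the integral sign. The Leibniz rule wants the derivative as a bounded
  linear function that is continuous in the operator norm; in finite dimension the latter follows
  from continuity in each basis direction.\<close>

lemma radial_mean_has_derivative:
  assumes F: "C_k_on (Suc k) (ball a r) F" and y: "y \<in> ball a r"
  shows "(radial_mean m a F has_derivative
    (\<lambda>v. radial_mean (Suc m) a (\<lambda>x. frechet_derivative F (at x) v) y)) (at y)"
proof -
  let ?D = "\<lambda>x. frechet_derivative F (at x)"
  \<comment> \<open>The case distinction only serves to have a bounded linear function for all arguments.\<close>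
  define fx where "fx y t = (if y \<in> ball a r \<and> t \<in> cbox 0 1
      then Blinfun (\<lambda>v. t ^ Suc m * ?D (a + t *\<^sub>R (y - a)) v) else 0)" for y and t :: real
  have D: "(F has_derivative ?D (a + t *\<^sub>R (y - a))) (at (a + t *\<^sub>R (y - a)))"
    if "y \<in> ball a r" "t \<in> cbox 0 1" for y and t :: real
    by (rule C_k_on_has_derivative[OF F radial_segment_in_ball[OF that]])
  have app: "blinfun_apply (fx y t) v = t ^ Suc m * ?D (a + t *\<^sub>R (y - a)) v"
    if "y \<in> ball a r" "t \<in> cbox 0 1" for y v and t :: real
  proof -
    have "bounded_linear (\<lambda>v. t ^ Suc m * ?D (a + t *\<^sub>R (y - a)) v)"
      by (intro bounded_linear_compose[OF bounded_linear_mult_right]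
          has_derivative_bounded_linear[OF D[OF that]])
    then show ?thesis using that by (simp add: fx_def bounded_linear_Blinfun_apply)
  qed
  have contD: "continuous_on (ball a r) (\<lambda>x. ?D x v)" for v
    using C_k_on_imp_continuous_on[OF C_k_on_derivative[OF F]] .
  have cont_fx: "continuous_on (ball a r \<times> cbox 0 1) (\<lambda>(y, t). fx y t)"
  proof (rule continuous_on_blinfun_componentwise)
    fix i :: 'a
    show "continuous_on (ball a r \<times> cbox 0 1)
        (\<lambda>z. blinfun_apply (case z of (y, t) \<Rightarrow> fx y t) i)"
      using continuous_on_radial[OF contD[of i], of "Suc m"]
      by (rule continuous_on_eq) (auto simp: app)
  qed
  have "((\<lambda>y. integral (cbox 0 1) (\<lambda>t. t ^ m * F (a + t *\<^sub>R (y - a)))) has_derivative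
      blinfun_apply (integral (cbox 0 1) (fx y))) (at y within ball a r)"
  proof (rule leibniz_rule[OF _ _ cont_fx y convex_ball])
    fix z and t :: real assume z: "z \<in> ball a r" "t \<in> cbox 0 1"
    have "((\<lambda>x. a + t *\<^sub>R (x - a)) has_derivative (\<lambda>v. t *\<^sub>R v)) (at z)"
      by (auto intro!: derivative_eq_intros)
    from has_derivative_compose[OF this D[OF z]]
    have "((\<lambda>x. F (a + t *\<^sub>R (x - a))) has_derivative
        (\<lambda>v. ?D (a + t *\<^sub>R (z - a)) (t *\<^sub>R v))) (at z)" .
    from has_derivative_mult_right[OF this, of "t ^ m"]
    have "((\<lambda>x. t ^ m * F (a + t *\<^sub>R (x - a))) has_derivative
        (\<lambda>v. t ^ m * ?D (a + t *\<^sub>R (z - a)) (t *\<^sub>R v))) (at z)" .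
    moreover have "(\<lambda>v. t ^ m * ?D (a + t *\<^sub>R (z - a)) (t *\<^sub>R v)) = blinfun_apply (fx z t)"
      using linear_scale[OF has_derivative_linear[OF D[OF z]]] by (auto simp: app[OF z])
    ultimately show "((\<lambda>x. t ^ m * F (a + t *\<^sub>R (x - a))) has_derivative blinfun_apply (fx z t))
        (at z within ball a r)"
      by (simp add: has_derivative_at_withinI)
  next
    fix z assume "z \<in> ball a r"
    then show "(\<lambda>t. t ^ m * F (a + t *\<^sub>R (z - a))) integrable_on cbox 0 1"
      by (intro integrable_continuous continuous_on_radial_segment[OF C_k_on_imp_continuous_on[OF F]])
  qed
  moreover have "at y within ball a r = at y"
    by (rule at_within_open[OF y open_ball])
  moreover have "blinfun_apply (integral (cbox 0 1) (fx y)) =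
      (\<lambda>v. radial_mean (Suc m) a (\<lambda>x. ?D x v) y)"
  proof
    fix v
    have "continuous_on (cbox 0 1) (\<lambda>t. fx y t)"
    proof -
      have "continuous_on (cbox 0 1) (\<lambda>t::real. (y, t))"
        by (intro continuous_intros)
      from continuous_on_compose2[OF cont_fx this] show ?thesis
        using y by (auto simp: image_subset_iff)
    qed
    then have "blinfun_apply (integral (cbox 0 1) (fx y)) v =
        integral (cbox 0 1) (\<lambda>t. blinfun_apply (fx y t) v)"
      by (intro blinfun_apply_integral integrable_continuous)
    also have "\<dots> = radial_mean (Suc m) a (\<lambda>x. ?D x v) y"
      unfolding radial_mean_def by (rule integral_cong) (simp add: app[OF y])
    finally show "blinfun_apply (integral (cbox 0 1) (fx y)) v =
        radial_mean (Suc m) a (\<lambda>x. ?D x v) y" .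
  qed
  ultimately show ?thesis
    unfolding radial_mean_def[abs_def] by metis
qed

text \<open>Each derivative of a radial mean is a radial mean of a derivative, which is why the induction
  is over all weights and integrands at once.\<close>

lemma C_k_on_radial_mean:
  "C_k_on k (ball a r) F \<Longrightarrow> C_k_on k (ball a r) (radial_mean m a F)"
proof (induction k arbitrary: F m)
  case 0
  then show ?case
    unfolding radial_mean_def[abs_def] C_k_on.simps
    by (intro integral_continuous_on_param continuous_on_radial)
next
  case (Suc k)
  show ?case
    by (intro C_k_on_Suc_if_has_derivative[OF open_ball radial_mean_has_derivative[OF Suc.prems]]
        Suc.IH C_k_on_derivative[OF Suc.prems])
qed

lemma smooth_on_radial_mean:
  "smooth_on (ball a r) F \<Longrightarrow> smooth_on (ball a r) (radial_mean m a F)"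
  by (simp add: smooth_on_def C_k_on_radial_mean)

lemma radial_mean_center: "radial_mean 0 a F a = F a"
  by (simp add: radial_mean_def)

text \<open>Integrate the derivative of \<open>t \<mapsto> F (a + t (y - a))\<close> from 0 to 1 and expand it in the basis.
  What matters is that the coefficients are again smooth in \<open>y\<close>, so that derivations can be applied
  to the products on the right.\<close>

lemma hadamard:
  assumes F: "smooth_on (ball a r) F" and y: "y \<in> ball a r"
  shows "F y = F a + (\<Sum>b\<in>Basis. ((y - a) \<bullet> b) *
    radial_mean 0 a (\<lambda>x. frechet_derivative F (at x) b) y)"
proof -
  let ?D = "\<lambda>x. frechet_derivative F (at x)"
  have cont: "continuous_on (cbox 0 1) (\<lambda>t::real. ?D (a + t *\<^sub>R (y - a)) b)" for b
    using continuous_on_radial_segment[OF smooth_on_imp_continuous_on[OF smooth_on_derivative[OF F]] y,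
        of 0 b] by simp
  have expand: "?D (a + t *\<^sub>R (y - a)) (y - a) =
      (\<Sum>b\<in>Basis. ((y - a) \<bullet> b) * ?D (a + t *\<^sub>R (y - a)) b)" if "t \<in> cbox 0 1" for t :: real
  proof -
    have lin: "linear (?D (a + t *\<^sub>R (y - a)))"
      by (rule has_derivative_linear[OF smooth_on_has_derivative[OF F radial_segment_in_ball[OF y that]]])
    show ?thesis
      by (subst euclidean_representation[of "y - a", symmetric])
        (simp only: linear_sum[OF lin] linear_scale[OF lin] real_scaleR_def)
  qed
  have "((\<lambda>t. ?D (a + t *\<^sub>R (y - a)) (y - a)) has_integral
      F (a + 1 *\<^sub>R (y - a)) - F (a + 0 *\<^sub>R (y - a))) {0..1}"
  proof (rule fundamental_theorem_of_calculus)
    fix t :: real assume t: "t \<in> {0..1}"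
    then have "t \<in> cbox 0 1" by simp
    note D = smooth_on_has_derivative[OF F radial_segment_in_ball[OF y this]]
    have "((\<lambda>t. a + t *\<^sub>R (y - a)) has_derivative (\<lambda>h. h *\<^sub>R (y - a))) (at t)"
      by (auto intro!: derivative_eq_intros)
    from has_derivative_compose[OF this D]
    show "((\<lambda>t. F (a + t *\<^sub>R (y - a))) has_vector_derivative ?D (a + t *\<^sub>R (y - a)) (y - a))
        (at t within {0..1})"
      unfolding has_vector_derivative_def
      using linear_scale[OF has_derivative_linear[OF D]] by (simp add: has_derivative_at_withinI)
  qed simp
  then have "F y - F a = integral (cbox 0 1) (\<lambda>t. ?D (a + t *\<^sub>R (y - a)) (y - a))"
    by (simp add: integral_unique)
  also have "\<dots> = integral (cbox 0 1) (\<lambda>t. \<Sum>b\<in>Basis. ((y - a) \<bullet> b) * ?D (a + t *\<^sub>R (y - a)) b)"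
    by (rule integral_cong) (rule expand)
  also have "\<dots> = (\<Sum>b\<in>Basis. ((y - a) \<bullet> b) * radial_mean 0 a (\<lambda>x. ?D x b) y)"
    by (subst integral_sum)
      (auto simp: radial_mean_def intro!: integrable_continuous_interval continuous_intros cont[simplified])
  finally show ?thesis by simp
qed


section \<open>The algebra of smooth functions on a manifold\<close>

lemma sum_fun_apply: "(\<Sum>i\<in>I. f i) x = (\<Sum>i\<in>I. f i x)"
  for f :: "'i \<Rightarrow> 'a \<Rightarrow> 'b::comm_monoid_add"
  by (induction I rule: infinite_finite_induct) auto

lemma scaleR_fun_apply: "(c *\<^sub>R f) x = c *\<^sub>R f x"
  by (simp add: scaleR_fun_def)

context smooth_manifold
begin

lemma chart_open: "(U, \<phi>) \<in> A \<Longrightarrow> open U"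
  using chart by blast

lemma chart_homeomorphism: "(U, \<phi>) \<in> A \<Longrightarrow> homeomorphism U (\<phi> ` U) \<phi> (inv_into U \<phi>)"
  using chart by blast

lemma chart_inv: "(U, \<phi>) \<in> A \<Longrightarrow> q \<in> U \<Longrightarrow> inv_into U \<phi> (\<phi> q) = q"
  using homeomorphism_apply1[OF chart_homeomorphism] by blast

lemma chart_open_image:
  assumes "(U, \<phi>) \<in> A" and "open N" and "N \<subseteq> U"
  shows "open (\<phi> ` N)"
proof -
  have "openin (top_of_set U) N"
    using assms(2,3) by (simp add: open_subset)
  then have "openin (top_of_set (\<phi> ` U)) (\<phi> ` N)"
    by (rule homeomorphism_imp_open_map[OF chart_homeomorphism[OF assms(1)]])
  moreover have "open (\<phi> ` U)" using chart assms(1) by blast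
  ultimately show ?thesis using openin_open_trans by blast
qed

lemma chart_open_preimage:
  assumes "(U, \<phi>) \<in> A" and "open B"
  shows "open {q \<in> U. \<phi> q \<in> B}"
proof -
  have "continuous_on U \<phi>"
    using chart_homeomorphism[OF assms(1)] by (simp add: homeomorphism_def)
  from continuous_open_preimage[OF this chart_open[OF assms(1)] assms(2)]
  show ?thesis by (simp add: vimage_def Int_def)
qed

lemma chart_at: obtains U \<phi> where "(U, \<phi>) \<in> A" and "p \<in> U"
proof -
  have "p \<in> (\<Union>(U, \<phi>)\<in>A. U)" using covering by simp
  then show thesis using that by auto
qed

lemma smooth_functionsI:
  assumes "\<And>U \<phi>. (U, \<phi>) \<in> A \<Longrightarrow> smooth_on (\<phi> ` U) (\<lambda>y. f (inv_into U \<phi> y))"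
  shows "f \<in> smooth_functions A"
  unfolding smooth_functions_def comp_def using assms by fast

lemma smooth_functionsD:
  "f \<in> smooth_functions A \<Longrightarrow> (U, \<phi>) \<in> A \<Longrightarrow> smooth_on (\<phi> ` U) (\<lambda>y. f (inv_into U \<phi> y))"
  by (auto simp: smooth_functions_def comp_def)

lemma chart_range_open: "(U, \<phi>) \<in> A \<Longrightarrow> open (\<phi> ` U)"
  using chart by blast

lemma smooth_functions_const: "(\<lambda>p. c) \<in> smooth_functions A"
  by (intro smooth_functionsI smooth_on_const)

lemma smooth_functions_add:
  assumes "f \<in> smooth_functions A" and "h \<in> smooth_functions A"
  shows "f + h \<in> smooth_functions A"
  unfolding plus_fun_def
  by (intro smooth_functionsI smooth_on_add smooth_functionsD[OF assms(1)]
      smooth_functionsD[OF assms(2)] chart_range_open)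

lemma smooth_functions_mult:
  assumes "f \<in> smooth_functions A" and "h \<in> smooth_functions A"
  shows "f * h \<in> smooth_functions A"
  unfolding times_fun_def
  by (intro smooth_functionsI smooth_on_mult smooth_functionsD[OF assms(1)]
      smooth_functionsD[OF assms(2)] chart_range_open)

lemma smooth_functions_scaleR: "f \<in> smooth_functions A \<Longrightarrow> c *\<^sub>R f \<in> smooth_functions A"
  using smooth_functions_mult[OF smooth_functions_const[of c]]
  by (simp add: times_fun_def scaleR_fun_def)

lemma smooth_functions_0: "0 \<in> smooth_functions A"
  using smooth_functions_const[of 0] by (simp add: zero_fun_def)

lemma smooth_functions_uminus: "f \<in> smooth_functions A \<Longrightarrow> - f \<in> smooth_functions A"
  using smooth_functions_scaleR[of f "-1"] by simp

lemma smooth_functions_diff: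
  "f \<in> smooth_functions A \<Longrightarrow> h \<in> smooth_functions A \<Longrightarrow> f - h \<in> smooth_functions A"
  using smooth_functions_add[of f "- h"] smooth_functions_uminus[of h] by simp

lemma smooth_functions_sum:
  "(\<And>i. i \<in> I \<Longrightarrow> f i \<in> smooth_functions A) \<Longrightarrow> (\<Sum>i\<in>I. f i) \<in> smooth_functions A"
  by (induction I rule: infinite_finite_induct)
    (auto intro: smooth_functions_0 smooth_functions_add)

lemma smooth_functions_inverse:
  assumes "f \<in> smooth_functions A" and "\<And>p. f p \<noteq> 0"
  shows "(\<lambda>p. inverse (f p)) \<in> smooth_functions A"
  by (intro smooth_functionsI smooth_on_inverse smooth_functionsD[OF assms(1)] chart_range_open)
    (simp_all add: assms(2))

lemma smooth_functions_compose:
  fixes k :: "real \<Rightarrow> real"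
  assumes "f \<in> smooth_functions A" and "smooth_on UNIV k"
  shows "(\<lambda>p. k (f p)) \<in> smooth_functions A"
  by (intro smooth_functionsI smooth_on_compose[OF smooth_functionsD[OF assms(1)] assms(2)]
      chart_range_open) auto

text \<open>Membership in \<^const>\<open>smooth_functions\<close> has to be checked in every chart; by compatibility of
  the charts one chart around each point is enough.\<close>

lemma smooth_functions_locally:
  assumes "\<And>q. \<exists>U \<phi> N. (U, \<phi>) \<in> A \<and> open N \<and> q \<in> N \<and> N \<subseteq> U \<and>
    smooth_on (\<phi> ` N) (\<lambda>y. f (inv_into U \<phi> y))"
  shows "f \<in> smooth_functions A"
proof (rule smooth_functionsI, rule smooth_on_locally)
  fix V \<psi> y assume V: "(V, \<psi>) \<in> A" and "y \<in> \<psi> ` V"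
  then obtain q where q: "q \<in> V" "y = \<psi> q" by blast
  obtain U \<phi> N where U: "(U, \<phi>) \<in> A" and N: "open N" "q \<in> N" "N \<subseteq> U"
    and f: "smooth_on (\<phi> ` N) (\<lambda>y. f (inv_into U \<phi> y))"
    using assms by blast
  have op: "open (\<psi> ` (V \<inter> N))"
    using N chart_open[OF V] by (intro chart_open_image[OF V]) auto
  have "smooth_on (\<psi> ` (V \<inter> N)) (\<lambda>z. \<phi> (inv_into V \<psi> z))"
    using compatible[OF V U] N(3)
    by (auto simp: comp_def intro: smooth_on_subset)
  moreover have "(\<lambda>z. \<phi> (inv_into V \<psi> z)) ` \<psi> ` (V \<inter> N) \<subseteq> \<phi> ` N"
    by (auto simp: chart_inv[OF V])
  ultimately have "smooth_on (\<psi> ` (V \<inter> N))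
      (\<lambda>z. f (inv_into U \<phi> (\<phi> (inv_into V \<psi> z))))"
    using smooth_on_compose[OF _ f op] by blast
  then have "smooth_on (\<psi> ` (V \<inter> N)) (\<lambda>z. f (inv_into V \<psi> z))"
    by (rule smooth_on_cong[OF _ op]) (use N(3) in \<open>auto simp: chart_inv[OF V] chart_inv[OF U]\<close>)
  moreover have "y \<in> \<psi> ` (V \<inter> N)" using q N(2) by blast
  ultimately show "\<exists>T. open T \<and> y \<in> T \<and> smooth_on T (\<lambda>z. f (inv_into V \<psi> z))"
    using op by (intro exI[of _ "\<psi> ` (V \<inter> N)"] conjI)
qed

lemma smooth_functions_if_locally_eq:
  assumes "\<And>p. \<exists>N h. open N \<and> p \<in> N \<and> h \<in> smooth_functions A \<and> (\<forall>q\<in>N. f q = h q)"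
  shows "f \<in> smooth_functions A"
proof (rule smooth_functions_locally)
  fix p
  obtain N h where N: "open N" "p \<in> N" and h: "h \<in> smooth_functions A" "\<And>q. q \<in> N \<Longrightarrow> f q = h q"
    using assms[of p] by auto
  obtain U \<phi> where U: "(U, \<phi>) \<in> A" "p \<in> U" by (rule chart_at)
  have op: "open (N \<inter> U)" using N(1) chart_open[OF U(1)] by blast
  have "smooth_on (\<phi> ` (N \<inter> U)) (\<lambda>y. h (inv_into U \<phi> y))"
    using smooth_functionsD[OF h(1) U(1)] by (rule smooth_on_subset) auto
  then have "smooth_on (\<phi> ` (N \<inter> U)) (\<lambda>y. f (inv_into U \<phi> y))"
    by (rule smooth_on_cong[OF _ chart_open_image[OF U(1) op]])
      (auto simp: chart_inv[OF U(1)] h(2))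
  then show "\<exists>U \<phi> N. (U, \<phi>) \<in> A \<and> open N \<and> p \<in> N \<and> N \<subseteq> U \<and>
      smooth_on (\<phi> ` N) (\<lambda>y. f (inv_into U \<phi> y))"
    using U N(2) op by (intro exI[of _ U] exI[of _ \<phi>] exI[of _ "N \<inter> U"]) auto
qed

text \<open>The set \<open>N\<close> and the complement of \<open>K\<close> form an open cover, and on the second set the function
  vanishes.\<close>

lemma smooth_functions_extend_by_zero:
  assumes U: "(U, \<phi>) \<in> A" and N: "open N" "N \<subseteq> U" and K: "closed K" "K \<subseteq> N"
    and f: "smooth_on (\<phi> ` N) (\<lambda>y. f (inv_into U \<phi> y))" and zero: "\<And>q. q \<notin> K \<Longrightarrow> f q = 0"
  shows "f \<in> smooth_functions A"
proof (rule smooth_functions_locally)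
  fix q
  show "\<exists>U \<phi> N. (U, \<phi>) \<in> A \<and> open N \<and> q \<in> N \<and> N \<subseteq> U \<and>
      smooth_on (\<phi> ` N) (\<lambda>y. f (inv_into U \<phi> y))"
  proof (cases "q \<in> N")
    case True
    then show ?thesis using U N f
      by (intro exI[of _ U] exI[of _ \<phi>] exI[of _ N] conjI)
  next
    case False
    obtain V \<psi> where V: "(V, \<psi>) \<in> A" "q \<in> V" by (rule chart_at)
    have op: "open (V - K)" using chart_open[OF V(1)] K(1) by (rule open_Diff)
    have "smooth_on (\<psi> ` (V - K)) (\<lambda>y. f (inv_into V \<psi> y))"
      by (rule smooth_on_cong[OF smooth_on_const[of _ 0] chart_open_image[OF V(1) op]])
        (auto simp: chart_inv[OF V(1)] zero)
    then show ?thesis using V op False K(2)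
      by (intro exI[of _ V] exI[of _ \<psi>] exI[of _ "V - K"]) auto
  qed
qed

text \<open>The plateau function of the rescaled squared distance from \<open>p\<close> in the chart, extended by zero.
  Its support \<open>K\<close> is closed because it is compact and the manifold is Hausdorff.\<close>

lemma bump_function:
  assumes U: "(U, \<phi>) \<in> A" "p \<in> U" and N: "open N" "p \<in> N"
  obtains \<beta> W K where "\<beta> \<in> smooth_functions A" and "open W" and "p \<in> W" and "W \<subseteq> U" and "closed K"
    and "K \<subseteq> N \<inter> U" and "\<And>q. q \<in> W \<Longrightarrow> \<beta> q = 1" and "\<And>q. q \<notin> K \<Longrightarrow> \<beta> q = 0"
proof -
  have "open (\<phi> ` (N \<inter> U))"
    using N(1) chart_open[OF U(1)] by (intro chart_open_image[OF U(1)]) auto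
  moreover have "\<phi> p \<in> \<phi> ` (N \<inter> U)" using U N by blast
  ultimately obtain r where r: "r > 0" "cball (\<phi> p) r \<subseteq> \<phi> ` (N \<inter> U)"
    unfolding open_contains_cball by blast
  \<comment> \<open>Scaled to reach 2, where the plateau function has become 0, at distance r.\<close>
  define s where "s q = 2 / r\<^sup>2 * ((\<phi> q - \<phi> p) \<bullet> (\<phi> q - \<phi> p))" for q
  define \<beta> where "\<beta> q = (if q \<in> U then plateau (s q) else 0)" for q
  define W where "W = {q \<in> U. \<phi> q \<in> ball (\<phi> p) (r / 2)}"
  define K where "K = inv_into U \<phi> ` cball (\<phi> p) r"
  have dist: "s q = 2 / r\<^sup>2 * (dist (\<phi> p) (\<phi> q))\<^sup>2" for q
    by (simp add: s_def dist_norm power2_norm_eq_inner norm_minus_commute[of "\<phi> p"])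
  have "continuous_on (\<phi> ` U) (inv_into U \<phi>)"
    using chart_homeomorphism[OF U(1)] by (simp add: homeomorphism_def)
  then have "continuous_on (cball (\<phi> p) r) (inv_into U \<phi>)"
    by (rule continuous_on_subset) (use r(2) in auto)
  then have K: "closed K"
    unfolding K_def by (intro compact_imp_closed compact_continuous_image compact_cball)
  have KN: "K \<subseteq> N \<inter> U"
    using r(2) chart_inv[OF U(1)] by (force simp: K_def)
  have zero: "\<beta> q = 0" if "q \<notin> K" for q
  proof (cases "q \<in> U")
    case True
    have "\<phi> q \<notin> cball (\<phi> p) r"
      using that chart_inv[OF U(1) True] by (force simp: K_def)
    then have "r\<^sup>2 \<le> (dist (\<phi> p) (\<phi> q))\<^sup>2"
      using r(1) by (intro power_mono) auto
    then have "2 \<le> s q"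
      using r(1) by (simp add: dist field_simps)
    then show ?thesis by (simp add: \<beta>_def plateau_eq_0)
  qed (simp add: \<beta>_def)
  have one: "\<beta> q = 1" if "q \<in> W" for q
  proof -
    have "(dist (\<phi> p) (\<phi> q))\<^sup>2 \<le> (r / 2)\<^sup>2"
      using that by (intro power_mono) (auto simp: W_def)
    then have "(dist (\<phi> p) (\<phi> q))\<^sup>2 \<le> r\<^sup>2 / 4"
      by (simp add: power_divide)
    with zero_le_power2[of "dist (\<phi> p) (\<phi> q)"]
    have "2 * (dist (\<phi> p) (\<phi> q))\<^sup>2 \<le> r\<^sup>2"
      by linarith
    then have "s q \<le> 1"
      using r(1) by (simp add: dist field_simps)
    then show ?thesis using that by (simp add: \<beta>_def W_def plateau_eq_1)
  qed
  have "\<beta> \<in> smooth_functions A"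
  proof (rule smooth_functions_extend_by_zero[OF U(1) chart_open[OF U(1)] order_refl K _ _ zero])
    show "K \<subseteq> U" using KN by blast
    have lin: "smooth_on UNIV (\<lambda>y. y + (- \<phi> p))"
      by (intro smooth_on_add smooth_on_const smooth_on_bounded_linear bounded_linear_ident open_UNIV)
    have "smooth_on UNIV (\<lambda>y. 2 / r\<^sup>2 * ((y + (- \<phi> p)) \<bullet> (y + (- \<phi> p))))"
      by (intro smooth_on_mult smooth_on_inner smooth_on_const lin open_UNIV)
    then have "smooth_on UNIV (\<lambda>y. plateau (2 / r\<^sup>2 * ((y + (- \<phi> p)) \<bullet> (y + (- \<phi> p)))))"
      by (rule smooth_on_compose[OF _ smooth_on_plateau]) auto
    then have "smooth_on (\<phi> ` U) (\<lambda>y. plateau (2 / r\<^sup>2 * ((y + (- \<phi> p)) \<bullet> (y + (- \<phi> p)))))"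
      by (rule smooth_on_subset) simp
    then show "smooth_on (\<phi> ` U) (\<lambda>y. \<beta> (inv_into U \<phi> y))"
      by (rule smooth_on_cong[OF _ chart_range_open[OF U(1)]])
        (auto simp: chart_inv[OF U(1)] \<beta>_def s_def)
  qed
  moreover have "open W"
    unfolding W_def by (rule chart_open_preimage[OF U(1) open_ball])
  moreover have "p \<in> W" "W \<subseteq> U" using U(2) r(1) by (auto simp: W_def)
  ultimately show thesis using that K KN zero one by blast
qed

lemma smooth_functions_continuous:
  assumes "f \<in> smooth_functions A"
  shows "continuous_on UNIV f"
  unfolding continuous_on_eq_continuous_at[OF open_UNIV]
proof
  fix p
  obtain U \<phi> where U: "(U, \<phi>) \<in> A" "p \<in> U" by (rule chart_at)
  have "continuous_on U \<phi>"
    using chart_homeomorphism[OF U(1)] by (simp add: homeomorphism_def)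
  with smooth_on_imp_continuous_on[OF smooth_functionsD[OF assms U(1)]]
  have "continuous_on U (\<lambda>q. f (inv_into U \<phi> (\<phi> q)))"
    by (rule continuous_on_compose2) simp
  then have "continuous_on U f"
    by (rule continuous_on_eq) (simp add: chart_inv[OF U(1)])
  then show "continuous (at p) f"
    using U(2) chart_open[OF U(1)] continuous_on_eq_continuous_at by blast
qed

text \<open>The function \<open>1/f\<close> is \<open>f / f\<^sup>2\<close>. Adding to the denominator a flat function of \<open>f\<^sup>2\<close> that is
  positive exactly where \<open>f\<^sup>2\<close> is small makes the quotient smooth on the whole manifold without
  changing it near \<open>p\<close>.\<close>

lemma local_inverse:
  assumes f: "f \<in> smooth_functions A" and p: "f p \<noteq> 0"
  obtains h N where "h \<in> smooth_functions A" and "open N" and "p \<in> N" and "\<And>q. q \<in> N \<Longrightarrow> h q * f q = 1"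
proof -
  define c where "c = (f p)\<^sup>2 / 2"
  define d where "d = (\<lambda>q. (f q)\<^sup>2 + flat_fun 0 (c - (f q)\<^sup>2))"
  have c: "c > 0" using p by (simp add: c_def)
  have sq: "f * f \<in> smooth_functions A" by (rule smooth_functions_mult[OF f f])
  have "(\<lambda>q. c) - f * f \<in> smooth_functions A"
    by (intro smooth_functions_diff smooth_functions_const sq)
  from smooth_functions_add[OF sq smooth_functions_compose[OF this smooth_on_flat_fun[of 0]]]
  have d: "d \<in> smooth_functions A"
    by (simp add: d_def plus_fun_def times_fun_def fun_diff_def power2_eq_square)
  have pos: "d q > 0" for q
  proof (cases "(f q)\<^sup>2 < c")
    case True
    then show ?thesis
      unfolding d_def by (intro add_nonneg_pos flat_fun_pos) auto
  next
    case False
    then show ?thesis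
      unfolding d_def using c by (intro add_pos_nonneg flat_fun_nonneg) auto
  qed
  let ?h = "f * (\<lambda>q. inverse (d q))"
  let ?N = "{q. c < (f q)\<^sup>2}"
  show thesis
  proof (rule that)
    show "?h \<in> smooth_functions A"
      by (intro smooth_functions_mult f smooth_functions_inverse d) (use pos in \<open>simp add: less_imp_neq[symmetric]\<close>)
    show "open ?N"
      by (intro open_Collect_less continuous_intros smooth_functions_continuous[OF f])
    show "p \<in> ?N" using p by (simp add: c_def)
    show "?h q * f q = 1" if "q \<in> ?N" for q
    proof -
      have "d q = f q * f q" "f q \<noteq> 0"
        using that c by (auto simp: d_def flat_fun_zero power2_eq_square)
      then show ?thesis by (simp add: field_simps)
    qed
  qed
qed


section \<open>Tangent vectors and vector fields\<close>

lemma tangent_add: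
  "v \<in> tangent_space A p \<Longrightarrow> f \<in> smooth_functions A \<Longrightarrow> h \<in> smooth_functions A \<Longrightarrow>
    v (f + h) = v f + v h"
  by (simp add: tangent_space_def linear_on_def)

lemma tangent_scaleR:
  "v \<in> tangent_space A p \<Longrightarrow> f \<in> smooth_functions A \<Longrightarrow> v (c *\<^sub>R f) = c * v f"
  by (simp add: tangent_space_def linear_on_def)

lemma tangent_mult:
  "v \<in> tangent_space A p \<Longrightarrow> f \<in> smooth_functions A \<Longrightarrow> h \<in> smooth_functions A \<Longrightarrow>
    v (f * h) = f p * v h + h p * v f"
  by (simp add: tangent_space_def)

lemma tangent_not_smooth: "v \<in> tangent_space A p \<Longrightarrow> f \<notin> smooth_functions A \<Longrightarrow> v f = 0"
  by (simp add: tangent_space_def)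

lemma tangent_zero: "v \<in> tangent_space A p \<Longrightarrow> v 0 = 0"
  using tangent_scaleR[of v p 0 0] smooth_functions_0 by simp

lemma tangent_diff:
  assumes "v \<in> tangent_space A p" and "f \<in> smooth_functions A" and "h \<in> smooth_functions A"
  shows "v (f - h) = v f - v h"
  using tangent_add[OF assms(1) smooth_functions_diff[OF assms(2,3)] assms(3)] by simp

lemma tangent_sum:
  assumes "v \<in> tangent_space A p" and "\<And>i. i \<in> I \<Longrightarrow> f i \<in> smooth_functions A"
  shows "v (\<Sum>i\<in>I. f i) = (\<Sum>i\<in>I. v (f i))"
  using assms(2) by (induction I rule: infinite_finite_induct)
    (auto simp: tangent_zero[OF assms(1)] tangent_add[OF assms(1)] smooth_functions_sum)

lemma tangent_const:
  assumes "v \<in> tangent_space A p"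
  shows "v (\<lambda>q. c) = 0"
proof -
  let ?one = "(\<lambda>q. 1) :: 'm \<Rightarrow> real"
  have one: "?one \<in> smooth_functions A" by (rule smooth_functions_const)
  have "?one * ?one = ?one" by (simp add: times_fun_def)
  with tangent_mult[OF assms one one] have "v ?one = 0" by simp
  moreover have "(\<lambda>q. c) = c *\<^sub>R ?one" by (simp add: scaleR_fun_def)
  ultimately show ?thesis using tangent_scaleR[OF assms one, of c] by simp
qed

text \<open>Multiplying the difference by a bump function supported where it vanishes gives the zero
  function, and the Leibniz rule isolates the value on the difference.\<close>

lemma tangent_local:
  assumes v: "v \<in> tangent_space A p" and f: "f \<in> smooth_functions A" and h: "h \<in> smooth_functions A"
    and N: "open N" "p \<in> N" and eq: "\<And>q. q \<in> N \<Longrightarrow> f q = h q"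
  shows "v f = v h"
proof -
  obtain U \<phi> where U: "(U, \<phi>) \<in> A" "p \<in> U" by (rule chart_at)
  obtain \<beta> W K where \<beta>: "\<beta> \<in> smooth_functions A" "p \<in> W" "K \<subseteq> N \<inter> U"
    "\<And>q. q \<in> W \<Longrightarrow> \<beta> q = 1" "\<And>q. q \<notin> K \<Longrightarrow> \<beta> q = 0"
    using bump_function[OF U N] by metis
  have "\<beta> * (f - h) = 0"
    using \<beta>(3,5) eq by (fastforce simp: fun_eq_iff)
  then have "\<beta> p * v (f - h) + (f - h) p * v \<beta> = 0"
    using tangent_mult[OF v \<beta>(1) smooth_functions_diff[OF f h]] tangent_zero[OF v] by simp
  then show ?thesis
    using \<beta>(2,4) eq[OF N(2)] tangent_diff[OF v f h] by simp
qed

lemma tangent_space_zero: "0 \<in> tangent_space A p"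
  by (simp add: tangent_space_def linear_on_def)

lemma tangent_space_add:
  "v \<in> tangent_space A p \<Longrightarrow> w \<in> tangent_space A p \<Longrightarrow> v + w \<in> tangent_space A p"
  by (simp add: tangent_space_def linear_on_def algebra_simps)

lemma tangent_space_scaleR: "v \<in> tangent_space A p \<Longrightarrow> c *\<^sub>R v \<in> tangent_space A p"
  by (simp add: tangent_space_def linear_on_def scaleR_fun_apply algebra_simps)

lemma tangent_space_sum:
  "(\<And>i. i \<in> I \<Longrightarrow> v i \<in> tangent_space A p) \<Longrightarrow> (\<Sum>i\<in>I. v i) \<in> tangent_space A p"
  by (induction I rule: infinite_finite_induct)
    (auto intro: tangent_space_zero tangent_space_add)

lemma tangent_space_uminus: "v \<in> tangent_space A p \<Longrightarrow> - v \<in> tangent_space A p"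
  using tangent_space_scaleR[of v p "-1"] by simp

lemma tangent_space_diff:
  "v \<in> tangent_space A p \<Longrightarrow> w \<in> tangent_space A p \<Longrightarrow> v - w \<in> tangent_space A p"
  using tangent_space_add[of v p "- w"] tangent_space_uminus[of w p] by simp

lemma vector_field_tangent: "X \<in> vector_fields A \<Longrightarrow> X p \<in> tangent_space A p"
  by (simp add: vector_fields_def)

lemma vector_field_deriv:
  "X \<in> vector_fields A \<Longrightarrow> f \<in> smooth_functions A \<Longrightarrow> field_deriv X f \<in> smooth_functions A"
  by (simp add: vector_fields_def)

lemma vector_fields_add:
  assumes "X \<in> vector_fields A" and "Y \<in> vector_fields A"
  shows "X + Y \<in> vector_fields A"
proof -
  have "field_deriv (X + Y) f = field_deriv X f + field_deriv Y f" for f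
    by (simp add: field_deriv_def fun_eq_iff)
  then show ?thesis
    using assms by (simp add: vector_fields_def tangent_space_add smooth_functions_add)
qed

lemma vector_fields_fmult:
  assumes "X \<in> vector_fields A" and "f \<in> smooth_functions A"
  shows "fmult f X \<in> vector_fields A"
proof -
  have "field_deriv (fmult f X) h = f * field_deriv X h" for h
    by (simp add: field_deriv_def fmult_def scaleR_fun_apply fun_eq_iff)
  then show ?thesis
    using assms by (simp add: vector_fields_def fmult_def tangent_space_scaleR smooth_functions_mult)
qed

lemma fmult_const: "fmult (\<lambda>p. c) X = c *\<^sub>R X"
  by (simp add: fmult_def scaleR_fun_def[of c])

lemma vector_fields_scaleR: "X \<in> vector_fields A \<Longrightarrow> c *\<^sub>R X \<in> vector_fields A"
  using vector_fields_fmult[OF _ smooth_functions_const[of c]] by (simp add: fmult_const)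

lemma vector_fields_zero: "0 \<in> vector_fields A"
proof -
  have "field_deriv 0 f = 0" for f :: "'m \<Rightarrow> real" by (simp add: field_deriv_def fun_eq_iff)
  then show ?thesis by (simp add: vector_fields_def tangent_space_zero smooth_functions_0)
qed

lemma vector_fields_sum:
  "(\<And>i. i \<in> I \<Longrightarrow> X i \<in> vector_fields A) \<Longrightarrow> (\<Sum>i\<in>I. X i) \<in> vector_fields A"
  by (induction I rule: infinite_finite_induct)
    (auto intro: vector_fields_zero vector_fields_add)

lemma vector_fields_diff:
  "X \<in> vector_fields A \<Longrightarrow> Y \<in> vector_fields A \<Longrightarrow> X - Y \<in> vector_fields A"
  using vector_fields_add[of X "(-1) *\<^sub>R Y"] vector_fields_scaleR[of Y "-1"] by simp

text \<open>In the Leibniz rule for the bracket the mixed first-order terms of the two compositions cancel.\<close>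

lemma vector_fields_lie_bracket:
  assumes X: "X \<in> vector_fields A" and Y: "Y \<in> vector_fields A"
  shows "lie_bracket X Y \<in> vector_fields A"
  unfolding vector_fields_def
proof (intro CollectI conjI allI ballI)
  note tX = vector_field_tangent[OF X] and tY = vector_field_tangent[OF Y]
  note dX = vector_field_deriv[OF X] and dY = vector_field_deriv[OF Y]
  have fadd: "field_deriv Z (f + h) = field_deriv Z f + field_deriv Z h"
    and fscale: "field_deriv Z (c *\<^sub>R f) = c *\<^sub>R field_deriv Z f"
    and fmult: "field_deriv Z (f * h) = f * field_deriv Z h + h * field_deriv Z f"
    if "Z \<in> vector_fields A" "f \<in> smooth_functions A" "h \<in> smooth_functions A" for Z f h c
    using tangent_add[OF vector_field_tangent] tangent_scaleR[OF vector_field_tangent]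
      tangent_mult[OF vector_field_tangent] that
    by (simp_all add: field_deriv_def fun_eq_iff scaleR_fun_apply)
  show "lie_bracket X Y p \<in> tangent_space A p" for p
    unfolding tangent_space_def linear_on_def
  proof (intro CollectI conjI ballI allI impI)
    fix f h assume f: "f \<in> smooth_functions A" and h: "h \<in> smooth_functions A"
    show "lie_bracket X Y p (f + h) = lie_bracket X Y p f + lie_bracket X Y p h"
      by (simp add: lie_bracket_def fadd[OF _ f h] X Y tangent_add[OF tX] tangent_add[OF tY] dX dY f h)
    have "X p (f * field_deriv Y h) = f p * X p (field_deriv Y h) + Y p h * X p f"
      "Y p (f * field_deriv X h) = f p * Y p (field_deriv X h) + X p h * Y p f"
      if "f \<in> smooth_functions A" "h \<in> smooth_functions A" for f h
      using tangent_mult[OF tX that(1) dY[OF that(2)]] tangent_mult[OF tY that(1) dX[OF that(2)]]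
      by (simp_all add: field_deriv_def)
    then show "lie_bracket X Y p (f * h) = f p * lie_bracket X Y p h + h p * lie_bracket X Y p f"
      by (simp add: lie_bracket_def fmult[OF _ f h] X Y tangent_add[OF tX] tangent_add[OF tY] dX dY
          f h smooth_functions_mult algebra_simps)
  next
    fix f c assume f: "f \<in> smooth_functions A"
    show "lie_bracket X Y p (c *\<^sub>R f) = c *\<^sub>R lie_bracket X Y p f"
      by (simp add: lie_bracket_def fscale[OF _ f f] X Y tangent_scaleR[OF tX] tangent_scaleR[OF tY]
          dX dY f algebra_simps)
  next
    fix f assume f: "f \<notin> smooth_functions A"
    have "field_deriv X f = 0" "field_deriv Y f = 0"
      using tangent_not_smooth[OF tX f] tangent_not_smooth[OF tY f]
      by (simp_all add: field_deriv_def fun_eq_iff)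
    then show "lie_bracket X Y p f = 0"
      by (simp add: lie_bracket_def tangent_zero[OF tX] tangent_zero[OF tY])
  qed
  show "field_deriv (lie_bracket X Y) f \<in> smooth_functions A" if f: "f \<in> smooth_functions A" for f
  proof -
    have "field_deriv (lie_bracket X Y) f =
        field_deriv X (field_deriv Y f) - field_deriv Y (field_deriv X f)"
      by (simp add: field_deriv_def lie_bracket_def fun_eq_iff)
    then show ?thesis using f by (simp add: dX dY smooth_functions_diff)
  qed
qed


section \<open>Local frames\<close>

text \<open>The partial derivative in direction \<open>b\<close> with respect to the chart, as a function on the
  manifold.\<close>

definition partial :: "'m set \<Rightarrow> ('m \<Rightarrow> 'e) \<Rightarrow> 'e \<Rightarrow> ('m \<Rightarrow> real) \<Rightarrow> 'm \<Rightarrow> real"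
  where "partial U \<phi> b f q = frechet_derivative (\<lambda>y. f (inv_into U \<phi> y)) (at (\<phi> q)) b"

lemma has_derivative_in_chart:
  assumes "(U, \<phi>) \<in> A" and "f \<in> smooth_functions A" and "q \<in> U"
  shows "((\<lambda>y. f (inv_into U \<phi> y)) has_derivative (\<lambda>b. partial U \<phi> b f q)) (at (\<phi> q))"
  unfolding partial_def
  by (rule smooth_on_has_derivative[OF smooth_functionsD[OF assms(2,1)]]) (use assms(3) in blast)

lemma partial_eqI:
  assumes "(U, \<phi>) \<in> A" and "f \<in> smooth_functions A" and "q \<in> U"
    and "((\<lambda>y. f (inv_into U \<phi> y)) has_derivative f') (at (\<phi> q))"
  shows "partial U \<phi> b f q = f' b"
  using has_derivative_unique[OF has_derivative_in_chart[OF assms(1-3)] assms(4)] by metis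

text \<open>Derivations are first-order differential operators. By Hadamard's lemma, \<open>f\<close> is near \<open>q\<close> a
  constant plus a sum of products \<open>(x\<^sub>b - x\<^sub>b q) \<gamma>\<^sub>b\<close>, and a derivation at \<open>q\<close> maps such a product to
  \<open>v x\<^sub>b\<close> times \<open>\<gamma>\<^sub>b q\<close>, the partial derivative. Since derivations act on globally defined functions,
  the \<open>x\<^sub>b\<close> are global functions that are coordinates only on \<open>W\<close>, and the \<open>\<gamma>\<^sub>b\<close> are cut off.\<close>

lemma tangent_vector_in_coordinates:
  assumes U: "(U, \<phi>) \<in> A" and W: "open W" "W \<subseteq> U" "q \<in> W"
    and x: "\<And>b. b \<in> Basis \<Longrightarrow> x b \<in> smooth_functions A"
      "\<And>b q. b \<in> Basis \<Longrightarrow> q \<in> W \<Longrightarrow> x b q = \<phi> q \<bullet> b"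
    and v: "v \<in> tangent_space A q" and f: "f \<in> smooth_functions A"
  shows "v f = (\<Sum>b\<in>Basis. v (x b) * partial U \<phi> b f q)"
proof -
  let ?F = "\<lambda>y. f (inv_into U \<phi> y)"
  have qU: "q \<in> U" using W by blast
  have "open (\<phi> ` W)" by (rule chart_open_image[OF U W(1,2)])
  then obtain r where r: "r > 0" "ball (\<phi> q) r \<subseteq> \<phi> ` W"
    using W(3) by (auto simp: open_contains_ball)
  have F: "smooth_on (ball (\<phi> q) r) ?F"
    using smooth_functionsD[OF f U] by (rule smooth_on_subset) (use r W(2) in blast)
  define N where "N = {q' \<in> U. \<phi> q' \<in> ball (\<phi> q) r}"
  have N: "open N" "q \<in> N" "N \<subseteq> U"
    using chart_open_preimage[OF U open_ball] r(1) W by (auto simp: N_def)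
  have NW: "N \<subseteq> W"
  proof
    fix q' assume q': "q' \<in> N"
    then obtain w where "w \<in> W" "\<phi> q' = \<phi> w" using r(2) by (auto simp: N_def)
    moreover have "q' \<in> U" using q' by (simp add: N_def)
    ultimately show "q' \<in> W"
      using W(2) chart_inv[OF U, of q'] chart_inv[OF U, of w] by auto
  qed
  have imN: "\<phi> ` N \<subseteq> ball (\<phi> q) r" by (auto simp: N_def)
  obtain \<beta> V K where \<beta>: "\<beta> \<in> smooth_functions A" "open V" "q \<in> V" "closed K" "K \<subseteq> N \<inter> U"
    "\<And>q'. q' \<in> V \<Longrightarrow> \<beta> q' = 1" "\<And>q'. q' \<notin> K \<Longrightarrow> \<beta> q' = 0"
    using bump_function[OF U qU N(1,2)] by metis
  define G where "G b = radial_mean 0 (\<phi> q) (\<lambda>z. frechet_derivative ?F (at z) b)" for b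
  define \<gamma> where "\<gamma> b = (\<lambda>q'. \<beta> q' * G b (\<phi> q'))" for b
  have \<gamma>: "\<gamma> b \<in> smooth_functions A" for b
  proof (rule smooth_functions_extend_by_zero[OF U N(1,3) \<beta>(4)])
    show "K \<subseteq> N" using \<beta>(5) by blast
    show "\<gamma> b q' = 0" if "q' \<notin> K" for q' using \<beta>(7)[OF that] by (simp add: \<gamma>_def)
    have op: "open (\<phi> ` N)" by (rule chart_open_image[OF U N(1,3)])
    have "smooth_on (\<phi> ` N) (G b)"
      unfolding G_def
      by (rule smooth_on_subset[OF smooth_on_radial_mean[OF smooth_on_derivative[OF F]] imN])
    moreover have "smooth_on (\<phi> ` N) (\<lambda>y. \<beta> (inv_into U \<phi> y))"
      using smooth_functionsD[OF \<beta>(1) U] by (rule smooth_on_subset) (use N(3) in blast)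
    ultimately have "smooth_on (\<phi> ` N) (\<lambda>y. \<beta> (inv_into U \<phi> y) * G b y)"
      by (intro smooth_on_mult op)
    then show "smooth_on (\<phi> ` N) (\<lambda>y. \<gamma> b (inv_into U \<phi> y))"
      by (rule smooth_on_cong[OF _ op]) (use N(3) in \<open>auto simp: \<gamma>_def chart_inv[OF U]\<close>)
  qed
  have \<gamma>q: "\<gamma> b q = partial U \<phi> b f q" for b
    using \<beta>(3,6) by (simp add: \<gamma>_def G_def radial_mean_center partial_def)
  let ?h = "(\<lambda>q'. f q) + (\<Sum>b\<in>Basis. (x b - (\<lambda>q'. x b q)) * \<gamma> b)"
  have xb: "x b - (\<lambda>q'. x b q) \<in> smooth_functions A" if "b \<in> Basis" for b
    by (intro smooth_functions_diff x that smooth_functions_const)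
  have summand: "(x b - (\<lambda>q'. x b q)) * \<gamma> b \<in> smooth_functions A" if "b \<in> Basis" for b
    by (rule smooth_functions_mult[OF xb[OF that] \<gamma>])
  have "v f = v ?h"
  proof (rule tangent_local[OF v f])
    show "?h \<in> smooth_functions A"
      by (intro smooth_functions_add smooth_functions_const smooth_functions_sum summand)
    show "open (V \<inter> N)" "q \<in> V \<inter> N" using \<beta> N by auto
    fix q' assume q': "q' \<in> V \<inter> N"
    then have "f q' = f q + (\<Sum>b\<in>Basis. ((\<phi> q' - \<phi> q) \<bullet> b) * G b (\<phi> q'))"
      using hadamard[OF F, of "\<phi> q'"] N(3) qU chart_inv[OF U] by (auto simp: N_def G_def)
    also have "\<dots> = ?h q'"
      using q' \<beta>(6) NW W(3) x(2)
      by (auto simp: sum_fun_apply \<gamma>_def inner_diff_left intro!: sum.cong)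
    finally show "f q' = ?h q'" .
  qed
  also have "\<dots> = (\<Sum>b\<in>Basis. v ((x b - (\<lambda>q'. x b q)) * \<gamma> b))"
    by (simp add: tangent_add[OF v] tangent_sum[OF v] tangent_const[OF v] summand
        smooth_functions_sum smooth_functions_const)
  also have "\<dots> = (\<Sum>b\<in>Basis. v (x b) * partial U \<phi> b f q)"
    by (rule sum.cong)
      (simp_all add: tangent_mult[OF v xb \<gamma>] tangent_diff[OF v] x smooth_functions_const
        tangent_const[OF v] \<gamma>q)
  finally show ?thesis .
qed

text \<open>A coordinate vector field of a chart, cut off by \<open>\<beta>\<close> so that it extends by zero. On functions
  that are not smooth it has to vanish by the normalisation of tangent vectors.\<close>

lemma coordinate_field:
  assumes U: "(U, \<phi>) \<in> A" and \<beta>: "\<beta> \<in> smooth_functions A"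
    and K: "closed K" "K \<subseteq> U" and zero: "\<And>q. q \<notin> K \<Longrightarrow> \<beta> q = 0"
  shows "(\<lambda>q f. if f \<in> smooth_functions A then \<beta> q * partial U \<phi> b f q else 0) \<in> vector_fields A"
    (is "?E \<in> _")
  unfolding vector_fields_def
proof (intro CollectI conjI allI ballI)
  fix q
  show "?E q \<in> tangent_space A q"
  proof (cases "q \<in> U")
    case False
    then have "\<beta> q = 0" using K zero by blast
    then have "?E q = 0" by (simp add: fun_eq_iff)
    then show ?thesis by (simp add: tangent_space_zero)
  next
    case True
    note D = has_derivative_in_chart[OF U _ True]
    have add: "partial U \<phi> b (f + h) q = partial U \<phi> b f q + partial U \<phi> b h q"
      and scale: "partial U \<phi> b (c *\<^sub>R f) q = c * partial U \<phi> b f q"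
      and mult: "partial U \<phi> b (f * h) q = f q * partial U \<phi> b h q + h q * partial U \<phi> b f q"
      if f: "f \<in> smooth_functions A" and h: "h \<in> smooth_functions A" for f h c
    proof -
      show "partial U \<phi> b (f + h) q = partial U \<phi> b f q + partial U \<phi> b h q"
        using has_derivative_add[OF D[OF f] D[OF h]]
        by (intro partial_eqI[OF U _ True] smooth_functions_add f h) simp
      show "partial U \<phi> b (c *\<^sub>R f) q = c * partial U \<phi> b f q"
        using has_derivative_mult_right[OF D[OF f], of c]
        by (intro partial_eqI[OF U _ True] smooth_functions_scaleR f) (simp add: scaleR_fun_apply)
      have "((\<lambda>y. (f * h) (inv_into U \<phi> y)) has_derivative
          (\<lambda>b. f q * partial U \<phi> b h q + h q * partial U \<phi> b f q)) (at (\<phi> q))"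
        using has_derivative_mult[OF D[OF f] D[OF h]] by (simp add: chart_inv[OF U True] mult.commute)
      then show "partial U \<phi> b (f * h) q = f q * partial U \<phi> b h q + h q * partial U \<phi> b f q"
        by (rule partial_eqI[OF U smooth_functions_mult[OF f h] True])
    qed
    show ?thesis
      unfolding tangent_space_def linear_on_def
      by (auto simp: smooth_functions_add smooth_functions_mult smooth_functions_scaleR add scale mult
          algebra_simps)
  qed
next
  fix f assume f: "f \<in> smooth_functions A"
  have op: "open (\<phi> ` U)" by (rule chart_range_open[OF U])
  show "field_deriv ?E f \<in> smooth_functions A"
  proof (rule smooth_functions_extend_by_zero[OF U chart_open[OF U] order_refl K])
    have "smooth_on (\<phi> ` U) (\<lambda>y. \<beta> (inv_into U \<phi> y) *
        frechet_derivative (\<lambda>y. f (inv_into U \<phi> y)) (at y) b)"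
      by (intro smooth_on_mult smooth_functionsD[OF \<beta> U] op
          smooth_on_derivative[OF smooth_functionsD[OF f U]])
    then show "smooth_on (\<phi> ` U) (\<lambda>y. field_deriv ?E f (inv_into U \<phi> y))"
      by (rule smooth_on_cong[OF _ op])
        (auto simp: field_deriv_def f partial_def chart_inv[OF U])
    show "field_deriv ?E f q = 0" if "q \<notin> K" for q
      using zero[OF that] by (simp add: field_deriv_def)
  qed
qed

text \<open>A smooth frame \<open>E\<close> on the open set \<open>W\<close> together with dual coordinates: the differentials of the
  \<open>x\<close> are the dual frame. The frame consists of globally defined fields so that operations defined
  only for global vector fields apply to it.\<close>

definition frame_on :: "'m set \<Rightarrow> ('e \<Rightarrow> 'm \<Rightarrow> real) \<Rightarrow> ('e \<Rightarrow> 'm field) \<Rightarrow> bool"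
  where "frame_on W x E \<longleftrightarrow> open W \<and>
    (\<forall>b\<in>Basis. x b \<in> smooth_functions A \<and> E b \<in> vector_fields A) \<and>
    (\<forall>q\<in>W. \<forall>b\<in>Basis. \<forall>c\<in>Basis. E b q (x c) = (if b = c then 1 else 0)) \<and>
    (\<forall>q\<in>W. \<forall>v\<in>tangent_space A q. v = (\<Sum>b\<in>Basis. v (x b) *\<^sub>R E b q))"

lemma frame_onD:
  assumes "frame_on W x E"
  shows "open W" and "b \<in> Basis \<Longrightarrow> x b \<in> smooth_functions A"
    and "b \<in> Basis \<Longrightarrow> E b \<in> vector_fields A"
    and "q \<in> W \<Longrightarrow> b \<in> Basis \<Longrightarrow> c \<in> Basis \<Longrightarrow> E b q (x c) = (if b = c then 1 else 0)"
    and "q \<in> W \<Longrightarrow> v \<in> tangent_space A q \<Longrightarrow> v = (\<Sum>b\<in>Basis. v (x b) *\<^sub>R E b q)"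
  using assms unfolding frame_on_def by blast+

lemma local_frame: obtains W x E where "p \<in> W" and "frame_on W x E"
proof -
  obtain U \<phi> where U: "(U, \<phi>) \<in> A" "p \<in> U" by (rule chart_at)
  obtain \<beta> W K where \<beta>: "\<beta> \<in> smooth_functions A" and W: "open W" "p \<in> W" "W \<subseteq> U"
    and K: "closed K" "K \<subseteq> U"
    and one: "\<And>q. q \<in> W \<Longrightarrow> \<beta> q = 1" and zero: "\<And>q. q \<notin> K \<Longrightarrow> \<beta> q = 0"
    using bump_function[OF U chart_open[OF U(1)] U(2)] by (metis Int_absorb)
  define x where "x b = (\<lambda>q. \<beta> q * (\<phi> q \<bullet> b))" for b
  define E where "E b = (\<lambda>q f. if f \<in> smooth_functions A then \<beta> q * partial U \<phi> b f q else 0)" for b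
  have xS: "x b \<in> smooth_functions A" for b
  proof (rule smooth_functions_extend_by_zero[OF U(1) chart_open[OF U(1)] order_refl K])
    have op: "open (\<phi> ` U)" by (rule chart_range_open[OF U(1)])
    have "smooth_on (\<phi> ` U) (\<lambda>y. \<beta> (inv_into U \<phi> y) * (y \<bullet> b))"
      by (intro smooth_on_mult smooth_functionsD[OF \<beta> U(1)] op smooth_on_bounded_linear
          bounded_linear_inner_left)
    then show "smooth_on (\<phi> ` U) (\<lambda>y. x b (inv_into U \<phi> y))"
      by (rule smooth_on_cong[OF _ op]) (auto simp: x_def chart_inv[OF U(1)])
    show "x b q = 0" if "q \<notin> K" for q using zero[OF that] by (simp add: x_def)
  qed
  have xW: "x b q = \<phi> q \<bullet> b" if "q \<in> W" for b q using one[OF that] by (simp add: x_def)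
  have EV: "E b \<in> vector_fields A" for b
    unfolding E_def by (rule coordinate_field[OF U(1) \<beta> K zero])
  have dual: "E b q (x c) = (if b = c then 1 else 0)"
    if q: "q \<in> W" and "b \<in> Basis" "c \<in> Basis" for q b c
  proof -
    have qU: "q \<in> U" using q W(3) by blast
    have "((\<lambda>y. y \<bullet> c) has_derivative (\<lambda>v. v \<bullet> c)) (at (\<phi> q))"
      by (intro bounded_linear_imp_has_derivative bounded_linear_inner_left)
    then have "((\<lambda>y. x c (inv_into U \<phi> y)) has_derivative (\<lambda>v. v \<bullet> c)) (at (\<phi> q))"
    proof (rule has_derivative_transform_within_open[OF _ chart_open_image[OF U(1) W(1,3)]])
      show "\<phi> q \<in> \<phi> ` W" using q by blast
      show "y \<bullet> c = x c (inv_into U \<phi> y)" if "y \<in> \<phi> ` W" for y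
        using that W(3) chart_inv[OF U(1)] xW by fastforce
    qed
    from partial_eqI[OF U(1) xS qU this, of b] show ?thesis
      using that one[OF q] xS by (simp add: E_def inner_Basis)
  qed
  have span: "v = (\<Sum>b\<in>Basis. v (x b) *\<^sub>R E b q)" if q: "q \<in> W" and v: "v \<in> tangent_space A q" for q v
  proof
    fix f
    show "v f = (\<Sum>b\<in>Basis. v (x b) *\<^sub>R E b q) f"
    proof (cases "f \<in> smooth_functions A")
      case True
      then show ?thesis
        using tangent_vector_in_coordinates[OF U(1) W(1,3) q _ _ v True, of x] xS xW one[OF q]
        by (simp add: sum_fun_apply scaleR_fun_apply E_def)
    next
      case False
      then show ?thesis
        using tangent_not_smooth[OF v False] by (simp add: sum_fun_apply scaleR_fun_apply E_def)
    qed
  qed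
  show thesis
  proof (rule that[of W x E])
    show "p \<in> W" by (rule W(2))
    show "frame_on W x E"
      unfolding frame_on_def
      by (intro conjI ballI) (rule W(1) xS EV dual span; assumption)+
  qed
qed

text \<open>Combine a local frame with constant coefficients.\<close>

lemma extend_tangent_vector:
  assumes "v \<in> tangent_space A p"
  obtains X where "X \<in> vector_fields A" and "X p = v"
proof -
  obtain W x E where W: "p \<in> W" and F: "frame_on W x E" by (rule local_frame)
  show thesis
  proof (rule that)
    show "(\<Sum>b\<in>Basis. v (x b) *\<^sub>R E b) \<in> vector_fields A"
      by (intro vector_fields_sum vector_fields_scaleR frame_onD(3)[OF F])
    show "(\<Sum>b\<in>Basis. v (x b) *\<^sub>R E b) p = v"
      using frame_onD(5)[OF F W assms] by (simp add: sum_fun_apply scaleR_fun_apply)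
  qed
qed

section \<open>One-forms and Lie derivatives\<close>

lemma field_deriv_add:
  "X \<in> vector_fields A \<Longrightarrow> f \<in> smooth_functions A \<Longrightarrow> h \<in> smooth_functions A \<Longrightarrow>
    field_deriv X (f + h) = field_deriv X f + field_deriv X h"
  by (simp add: field_deriv_def fun_eq_iff tangent_add[OF vector_field_tangent])

lemma field_deriv_mult:
  "X \<in> vector_fields A \<Longrightarrow> f \<in> smooth_functions A \<Longrightarrow> h \<in> smooth_functions A \<Longrightarrow>
    field_deriv X (f * h) = f * field_deriv X h + h * field_deriv X f"
  by (simp add: field_deriv_def fun_eq_iff tangent_mult[OF vector_field_tangent])

lemma field_deriv_field_add: "field_deriv (X + Y) f = field_deriv X f + field_deriv Y f"
  by (simp add: field_deriv_def fun_eq_iff)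

lemma field_deriv_fmult: "field_deriv (fmult h X) f = h * field_deriv X f"
  by (simp add: field_deriv_def fmult_def scaleR_fun_apply fun_eq_iff)

lemma field_deriv_const: "X \<in> vector_fields A \<Longrightarrow> field_deriv X (\<lambda>p. c) = 0"
  by (simp add: field_deriv_def fun_eq_iff tangent_const[OF vector_field_tangent])

text \<open>Turns identities between fields into identities between the first-order operators, where they
  can be proved by rewriting.\<close>

lemma vector_field_eqI:
  assumes "X \<in> vector_fields A" and "Y \<in> vector_fields A"
    and "\<And>f. f \<in> smooth_functions A \<Longrightarrow> field_deriv X f = field_deriv Y f"
  shows "X = Y"
proof (intro ext)
  fix p f
  show "X p f = Y p f"
    using tangent_not_smooth[OF vector_field_tangent[OF assms(1)]]
      tangent_not_smooth[OF vector_field_tangent[OF assms(2)]] fun_cong[OF assms(3), of f p]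
    by (cases "f \<in> smooth_functions A") (simp_all add: field_deriv_def)
qed

lemma field_deriv_lie_bracket:
  "field_deriv (lie_bracket X Y) f = field_deriv X (field_deriv Y f) - field_deriv Y (field_deriv X f)"
  by (simp add: field_deriv_def lie_bracket_def fun_eq_iff)

lemma lie_bracket_swap: "lie_bracket Y X = - lie_bracket X Y"
  by (simp add: lie_bracket_def fun_eq_iff)

lemma lie_bracket_add_right:
  assumes X: "X \<in> vector_fields A" and Y: "Y \<in> vector_fields A" and Z: "Z \<in> vector_fields A"
  shows "lie_bracket X (Y + Z) = lie_bracket X Y + lie_bracket X Z"
  by (rule vector_field_eqI)
    (simp_all add: vector_fields_lie_bracket vector_fields_add X Y Z field_deriv_lie_bracket
      field_deriv_field_add field_deriv_add vector_field_deriv)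

lemma lie_bracket_add_left:
  assumes "X \<in> vector_fields A" and "Y \<in> vector_fields A" and "Z \<in> vector_fields A"
  shows "lie_bracket (X + Y) Z = lie_bracket X Z + lie_bracket Y Z"
  by (simp add: lie_bracket_swap[of _ Z] lie_bracket_add_right[OF assms(3,1,2)])

lemma lie_bracket_fmult_right:
  assumes X: "X \<in> vector_fields A" and Y: "Y \<in> vector_fields A" and f: "f \<in> smooth_functions A"
  shows "lie_bracket X (fmult f Y) = fmult f (lie_bracket X Y) + fmult (field_deriv X f) Y"
  by (rule vector_field_eqI)
    (simp_all add: vector_fields_lie_bracket vector_fields_add vector_fields_fmult X Y f
      field_deriv_lie_bracket field_deriv_field_add field_deriv_fmult field_deriv_mult
      vector_field_deriv algebra_simps)

lemma lie_bracket_fmult_left: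
  assumes "X \<in> vector_fields A" and "Y \<in> vector_fields A" and "f \<in> smooth_functions A"
  shows "lie_bracket (fmult f X) Y = fmult f (lie_bracket X Y) - fmult (field_deriv Y f) X"
  unfolding lie_bracket_swap[of _ Y] lie_bracket_fmult_right[OF assms(2,1,3)]
  by (simp add: fmult_def fun_eq_iff scaleR_fun_apply)

lemma one_form_linear: "\<omega> \<in> one_forms A \<Longrightarrow> linear_on (tangent_space A p) (\<omega> p)"
  by (simp add: one_forms_def)

lemma one_form_smooth:
  "\<omega> \<in> one_forms A \<Longrightarrow> X \<in> vector_fields A \<Longrightarrow> form_app \<omega> X \<in> smooth_functions A"
  by (simp add: one_forms_def)

lemma form_app_add:
  "\<omega> \<in> one_forms A \<Longrightarrow> X \<in> vector_fields A \<Longrightarrow> Y \<in> vector_fields A \<Longrightarrow>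
    form_app \<omega> (X + Y) = form_app \<omega> X + form_app \<omega> Y"
  using one_form_linear[of \<omega>]
  by (simp add: linear_on_def form_app_def fun_eq_iff vector_field_tangent)

lemma form_app_fmult:
  "\<omega> \<in> one_forms A \<Longrightarrow> X \<in> vector_fields A \<Longrightarrow> form_app \<omega> (fmult f X) = f * form_app \<omega> X"
  using one_form_linear[of \<omega>]
  by (simp add: linear_on_def form_app_def fmult_def fun_eq_iff vector_field_tangent)

text \<open>Every tangent vector is a value of some vector field, so the values on vector fields determine a
  form. This gives the uniqueness needed to identify \<^const>\<open>lie_deriv\<close>.\<close>

lemma one_form_eqI:
  assumes "\<omega> \<in> one_forms A" and "\<eta> \<in> one_forms A"
    and eq: "\<And>Y. Y \<in> vector_fields A \<Longrightarrow> form_app \<omega> Y = form_app \<eta> Y"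
  shows "\<omega> = \<eta>"
proof (intro ext)
  fix p v
  show "\<omega> p v = \<eta> p v"
  proof (cases "v \<in> tangent_space A p")
    case True
    then obtain Y where Y: "Y \<in> vector_fields A" "Y p = v"
      by (rule extend_tangent_vector)
    then show ?thesis
      using fun_cong[OF eq[OF Y(1)], of p] by (simp add: form_app_def)
  next
    case False
    then show ?thesis using assms(1,2) by (simp add: one_forms_def)
  qed
qed

lemma one_forms_add:
  assumes "\<omega> \<in> one_forms A" and "\<eta> \<in> one_forms A"
  shows "\<omega> + \<eta> \<in> one_forms A"
proof -
  have "form_app (\<omega> + \<eta>) X = form_app \<omega> X + form_app \<eta> X" for X
    by (simp add: form_app_def fun_eq_iff)
  then show ?thesis
    using assms by (simp add: one_forms_def linear_on_def smooth_functions_add algebra_simps)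
qed

text \<open>Tensoriality: near \<open>p\<close> a field is a combination of a frame with smooth coefficients, and after
  multiplication by a bump function this holds globally. Linearity over the smooth functions then
  gives \<open>T Z p = (\<Sum>b. Z p (x b) * T (E b) p)\<close>, which involves only the value \<open>Z p\<close>.\<close>

lemma function_linear_is_pointwise:
  assumes add: "\<And>X Y. X \<in> vector_fields A \<Longrightarrow> Y \<in> vector_fields A \<Longrightarrow> T (X + Y) = T X + T Y"
    and fmult: "\<And>f X. f \<in> smooth_functions A \<Longrightarrow> X \<in> vector_fields A \<Longrightarrow> T (fmult f X) = f * T X"
    and X: "X \<in> vector_fields A" and Y: "Y \<in> vector_fields A" and eq: "X p = Y p"
  shows "T X p = (T Y p :: real)"
proof -
  obtain W x E where W: "p \<in> W" and F: "frame_on W x E" by (rule local_frame)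
  obtain U \<phi> where U: "(U, \<phi>) \<in> A" "p \<in> U" by (rule chart_at)
  obtain \<beta> V K where \<beta>: "\<beta> \<in> smooth_functions A" "p \<in> V" "K \<subseteq> W \<inter> U"
    "\<And>q. q \<in> V \<Longrightarrow> \<beta> q = 1" "\<And>q. q \<notin> K \<Longrightarrow> \<beta> q = 0"
    using bump_function[OF U frame_onD(1)[OF F] W] by metis
  have T0: "T 0 = 0"
    using add[OF vector_fields_zero vector_fields_zero] by simp
  have Tsum: "T (\<Sum>i\<in>I. Z i) = (\<Sum>i\<in>I. T (Z i))"
    if "\<And>i. i \<in> I \<Longrightarrow> Z i \<in> vector_fields A" for I :: "'e set" and Z
    using that by (induction I rule: infinite_finite_induct) (auto simp: T0 add vector_fields_sum)
  have "T Z p = (\<Sum>b\<in>Basis. Z p (x b) * T (E b) p)" if Z: "Z \<in> vector_fields A" for Z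
  proof -
    have "fmult \<beta> Z = (\<Sum>b\<in>Basis. fmult (\<beta> * field_deriv Z (x b)) (E b))"
    proof
      fix q
      show "fmult \<beta> Z q = (\<Sum>b\<in>Basis. fmult (\<beta> * field_deriv Z (x b)) (E b)) q"
      proof (cases "q \<in> W")
        case True
        have "\<beta> q *\<^sub>R Z q = \<beta> q *\<^sub>R (\<Sum>b\<in>Basis. Z q (x b) *\<^sub>R E b q)"
          using frame_onD(5)[OF F True vector_field_tangent[OF Z]] by simp
        then show ?thesis
          by (simp add: fmult_def sum_fun_apply field_deriv_def scaleR_sum_right)
      next
        case False
        then have "\<beta> q = 0" using \<beta>(3,5) by blast
        then show ?thesis by (simp add: fmult_def sum_fun_apply)
      qed
    qed
    moreover have c: "\<beta> * field_deriv Z (x b) \<in> smooth_functions A" if "b \<in> Basis" for b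
      by (intro smooth_functions_mult \<beta>(1) vector_field_deriv Z frame_onD(2)[OF F] that)
    ultimately have "\<beta> * T Z = (\<Sum>b\<in>Basis. (\<beta> * field_deriv Z (x b)) * T (E b))"
      using fmult[OF \<beta>(1) Z] by (simp add: Tsum fmult vector_fields_fmult frame_onD(3)[OF F])
    from fun_cong[OF this, of p] show ?thesis
      using \<beta>(2,4) by (simp add: sum_fun_apply field_deriv_def)
  qed
  then show ?thesis using X Y eq by simp
qed

text \<open>The form whose value on a tangent vector is read off from an arbitrary extension of it to a
  vector field; for \<open>T\<close> linear over the smooth functions the choice is immaterial.\<close>

definition tensor_form :: "('m field \<Rightarrow> 'm \<Rightarrow> real) \<Rightarrow> 'm form"
  where "tensor_form T =
    (\<lambda>p v. if v \<in> tangent_space A p then T (SOME Y. Y \<in> vector_fields A \<and> Y p = v) p else 0)"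

lemma tensor_form:
  assumes add: "\<And>X Y. X \<in> vector_fields A \<Longrightarrow> Y \<in> vector_fields A \<Longrightarrow> T (X + Y) = T X + T Y"
    and fmult: "\<And>f X. f \<in> smooth_functions A \<Longrightarrow> X \<in> vector_fields A \<Longrightarrow> T (fmult f X) = f * T X"
    and smooth: "\<And>X. X \<in> vector_fields A \<Longrightarrow> T X \<in> smooth_functions A"
  shows "tensor_form T \<in> one_forms A"
    and "\<And>X. X \<in> vector_fields A \<Longrightarrow> form_app (tensor_form T) X = T X"
proof -
  have at: "tensor_form T p (Y p) = T Y p" if Y: "Y \<in> vector_fields A" for Y p
  proof -
    let ?P = "\<lambda>Z. Z \<in> vector_fields A \<and> Z p = Y p"
    have "?P (Eps ?P)" by (rule someI[of ?P Y]) (simp add: Y)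
    then have "T (Eps ?P) p = T Y p"
      using function_linear_is_pointwise[of T, OF add fmult] Y by blast
    then show ?thesis by (simp add: tensor_form_def vector_field_tangent[OF Y])
  qed
  show app: "form_app (tensor_form T) X = T X" if "X \<in> vector_fields A" for X
    by (simp add: form_app_def at[OF that])
  show "tensor_form T \<in> one_forms A"
    unfolding one_forms_def linear_on_def
  proof (intro CollectI conjI allI ballI impI)
    fix p v assume v: "v \<in> tangent_space A p"
    obtain Y where Y: "Y \<in> vector_fields A" "Y p = v" by (rule extend_tangent_vector[OF v])
    show "tensor_form T p (c *\<^sub>R v) = c *\<^sub>R tensor_form T p v" for c
      using at[OF vector_fields_fmult[OF Y(1) smooth_functions_const[of c]], of p] at[OF Y(1), of p]
        fmult[OF smooth_functions_const[of c] Y(1)]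
      by (simp add: fmult_def Y(2))
    fix w assume w: "w \<in> tangent_space A p"
    obtain Z where Z: "Z \<in> vector_fields A" "Z p = w" by (rule extend_tangent_vector[OF w])
    show "tensor_form T p (v + w) = tensor_form T p v + tensor_form T p w"
      using at[OF vector_fields_add[OF Y(1) Z(1)], of p] at[OF Y(1), of p] at[OF Z(1), of p]
      by (simp add: add[OF Y(1) Z(1)] Y(2) Z(2))
  next
    show "tensor_form T p v = 0" if "v \<notin> tangent_space A p" for p v
      using that by (simp add: tensor_form_def)
    show "form_app (tensor_form T) X \<in> smooth_functions A" if "X \<in> vector_fields A" for X
      by (simp add: app smooth that)
  qed
qed

text \<open>In the formula for \<open>X(\<omega>(fY)) - \<omega>([X, fY])\<close> the two terms \<open>X(f) \<omega>(Y)\<close> cancel, so it is linear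
  over the smooth functions in \<open>Y\<close> and defines a unique form.\<close>

lemma lie_deriv:
  assumes X: "X \<in> vector_fields A" and \<omega>: "\<omega> \<in> one_forms A"
  shows "lie_deriv A X \<omega> \<in> one_forms A"
    and "\<And>Y. Y \<in> vector_fields A \<Longrightarrow> form_app (lie_deriv A X \<omega>) Y =
      field_deriv X (form_app \<omega> Y) - form_app \<omega> (lie_bracket X Y)"
proof -
  define T where "T Y = field_deriv X (form_app \<omega> Y) - form_app \<omega> (lie_bracket X Y)" for Y
  let ?P = "\<lambda>\<eta>. \<eta> \<in> one_forms A \<and> (\<forall>Y\<in>vector_fields A. form_app \<eta> Y =
    field_deriv X (form_app \<omega> Y) - form_app \<omega> (lie_bracket X Y))"
  have add: "T (Y + Z) = T Y + T Z" if "Y \<in> vector_fields A" "Z \<in> vector_fields A" for Y Z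
    using that X \<omega> by (simp add: T_def form_app_add lie_bracket_add_right field_deriv_add
        one_form_smooth vector_fields_lie_bracket)
  have fmult: "T (fmult f Y) = f * T Y" if "f \<in> smooth_functions A" "Y \<in> vector_fields A" for f Y
    using that X \<omega> by (simp add: T_def form_app_add form_app_fmult lie_bracket_fmult_right
        field_deriv_mult one_form_smooth vector_fields_lie_bracket vector_fields_fmult
        vector_field_deriv algebra_simps)
  have smooth: "T Y \<in> smooth_functions A" if "Y \<in> vector_fields A" for Y
    using that X \<omega> by (simp add: T_def smooth_functions_diff vector_field_deriv one_form_smooth
        vector_fields_lie_bracket)
  have "?P (tensor_form T)"
    using tensor_form[of T, OF add fmult smooth] by (simp add: T_def)
  moreover have "\<eta> = tensor_form T" if "?P \<eta>" for \<eta>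
    using that calculation by (intro one_form_eqI) auto
  ultimately have "?P (lie_deriv A X \<omega>)"
    unfolding lie_deriv_def by (rule theI)
  then show "lie_deriv A X \<omega> \<in> one_forms A"
    and "\<And>Y. Y \<in> vector_fields A \<Longrightarrow> form_app (lie_deriv A X \<omega>) Y =
      field_deriv X (form_app \<omega> Y) - form_app \<omega> (lie_bracket X Y)"
    by blast+
qed

end


section \<open>Musical isomorphisms\<close>

context riemannian_manifold
begin

lemma metric_add_right:
  "v \<in> tangent_space A p \<Longrightarrow> w \<in> tangent_space A p \<Longrightarrow> w' \<in> tangent_space A p \<Longrightarrow>
    g p v (w + w') = g p v w + g p v w'"
  using metric_linear[of v p] by (simp add: linear_on_def)

lemma metric_scaleR_right:
  "v \<in> tangent_space A p \<Longrightarrow> w \<in> tangent_space A p \<Longrightarrow> g p v (c *\<^sub>R w) = c * g p v w"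
  using metric_linear[of v p] by (simp add: linear_on_def)

lemma metric_add_left:
  "v \<in> tangent_space A p \<Longrightarrow> w \<in> tangent_space A p \<Longrightarrow> w' \<in> tangent_space A p \<Longrightarrow>
    g p (w + w') v = g p w v + g p w' v"
  using metric_add_right[of v p w w'] by (simp add: metric_sym[of _ p v] tangent_space_add)

lemma metric_scaleR_left:
  "v \<in> tangent_space A p \<Longrightarrow> w \<in> tangent_space A p \<Longrightarrow> g p (c *\<^sub>R w) v = c * g p w v"
  using metric_scaleR_right[of v p w c] by (simp add: metric_sym[of _ p v] tangent_space_scaleR)

lemma metric_zero_left: "v \<in> tangent_space A p \<Longrightarrow> g p 0 v = 0"
  using metric_scaleR_left[of v p 0 0] by (simp add: tangent_space_zero)

lemma metric_diff_left:
  "v \<in> tangent_space A p \<Longrightarrow> w \<in> tangent_space A p \<Longrightarrow> w' \<in> tangent_space A p \<Longrightarrow>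
    g p (w - w') v = g p w v - g p w' v"
  using metric_add_left[of v p "w - w'" w'] by (simp add: tangent_space_diff)

lemma metric_sum_left:
  assumes "v \<in> tangent_space A p" and "\<And>i. i \<in> I \<Longrightarrow> w i \<in> tangent_space A p"
  shows "g p (\<Sum>i\<in>I. w i) v = (\<Sum>i\<in>I. g p (w i) v)"
  using assms(2) by (induction I rule: infinite_finite_induct)
    (auto simp: metric_zero_left assms(1) metric_add_left tangent_space_sum)

lemma metric_nondegenerate:
  assumes v: "v \<in> tangent_space A p" and w: "w \<in> tangent_space A p"
    and eq: "\<And>u. u \<in> tangent_space A p \<Longrightarrow> g p v u = g p w u"
  shows "v = w"
proof (rule ccontr)
  assume "v \<noteq> w"
  then have "g p (v - w) (v - w) > 0"
    by (intro metric_pos tangent_space_diff v w) simp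
  then show False
    using metric_diff_left[OF tangent_space_diff[OF v w] v w] eq[OF tangent_space_diff[OF v w]] by simp
qed

definition inner_product :: "'m field \<Rightarrow> 'm field \<Rightarrow> 'm \<Rightarrow> real"
  where "inner_product X Y = (\<lambda>p. g p (X p) (Y p))"

lemma inner_product_smooth:
  "X \<in> vector_fields A \<Longrightarrow> Y \<in> vector_fields A \<Longrightarrow> inner_product X Y \<in> smooth_functions A"
  unfolding inner_product_def by (rule metric_smooth)

text \<open>The functions \<open>h\<close> are the reciprocals of the squared lengths. Carrying them along avoids
  normalising, hence taking square roots of smooth functions.\<close>

definition orthogonal_frame_at ::
    "'m \<Rightarrow> 'e set \<Rightarrow> ('e \<Rightarrow> 'm field) \<Rightarrow> ('e \<Rightarrow> 'm \<Rightarrow> real) \<Rightarrow> bool"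
  where "orthogonal_frame_at q S F h \<longleftrightarrow>
    (\<forall>i\<in>S. \<forall>j\<in>S. i \<noteq> j \<longrightarrow> g q (F i q) (F j q) = 0) \<and>
    (\<forall>i\<in>S. h i q * g q (F i q) (F i q) = 1)"

text \<open>One new vector is orthogonalised at a time, \<open>G = E k - P\<close> with \<open>P\<close> the projection to the span of
  the earlier \<open>F\<close>. The neighbourhood \<open>N\<close> shrinks in each step because the reciprocal of the squared
  length of \<open>G\<close> exists only near \<open>p\<close>. That \<open>G\<close> does not vanish there is seen from the dual
  coordinates: the earlier \<open>F\<close> are killed by the coordinates outside \<open>S\<close>, so that \<open>G\<close> maps \<open>x k\<close> to 1.
  The last clause says that the \<open>F\<close> span the same vectors as the \<open>E\<close>, in the form of the orthogonal
  expansion.\<close>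

lemma gram_schmidt:
  assumes frame: "frame_on W x E" and p: "p \<in> W" and "finite S" and "S \<subseteq> Basis"
  shows "\<exists>N F h. open N \<and> p \<in> N \<and> N \<subseteq> W \<and>
    (\<forall>i\<in>S. F i \<in> vector_fields A \<and> h i \<in> smooth_functions A) \<and>
    (\<forall>q\<in>N. orthogonal_frame_at q S F h \<and>
      (\<forall>i\<in>S. \<forall>b\<in>Basis - S. F i q (x b) = 0) \<and>
      (\<forall>j\<in>S. E j q = (\<Sum>i\<in>S. (h i q * g q (E j q) (F i q)) *\<^sub>R F i q)))"
  using \<open>finite S\<close> \<open>S \<subseteq> Basis\<close>
proof (induction S rule: finite_induct)
  case empty
  show ?case
    using p frame_onD(1)[OF frame] by (auto simp: orthogonal_frame_at_def)
next
  case (insert k S)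
  then have "S \<subseteq> Basis" by simp
  from insert.IH[OF this] obtain N F h where N: "open N" "p \<in> N" "N \<subseteq> W"
    and Fh: "\<forall>i\<in>S. F i \<in> vector_fields A \<and> h i \<in> smooth_functions A"
    and onN: "\<forall>q\<in>N. orthogonal_frame_at q S F h \<and>
      (\<forall>i\<in>S. \<forall>b\<in>Basis - S. F i q (x b) = 0) \<and>
      (\<forall>j\<in>S. E j q = (\<Sum>i\<in>S. (h i q * g q (E j q) (F i q)) *\<^sub>R F i q))"
    by (elim exE conjE) (rule that)
  from Fh have F: "\<And>i. i \<in> S \<Longrightarrow> F i \<in> vector_fields A"
    and h: "\<And>i. i \<in> S \<Longrightarrow> h i \<in> smooth_functions A" by blast+
  from onN have frameN: "\<And>q. q \<in> N \<Longrightarrow> orthogonal_frame_at q S F h"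
    and Fx: "\<And>q i b. q \<in> N \<Longrightarrow> i \<in> S \<Longrightarrow> b \<in> Basis - S \<Longrightarrow> F i q (x b) = 0"
    and EF: "\<And>q j. q \<in> N \<Longrightarrow> j \<in> S \<Longrightarrow>
      E j q = (\<Sum>i\<in>S. (h i q * g q (E j q) (F i q)) *\<^sub>R F i q)" by blast+
  have k: "k \<in> Basis" "k \<notin> S" "finite S" "S \<subseteq> Basis" using insert.hyps insert.prems by auto
  define P where "P = (\<Sum>i\<in>S. fmult (h i * inner_product (E k) (F i)) (F i))"
  define G where "G = E k - P"
  have Ek: "E k \<in> vector_fields A" by (rule frame_onD(3)[OF frame k(1)])
  have P: "P \<in> vector_fields A"
    unfolding P_def
    by (intro vector_fields_sum vector_fields_fmult smooth_functions_mult inner_product_smooth F h Ek)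
  have G: "G \<in> vector_fields A" unfolding G_def by (intro vector_fields_diff Ek P)
  have Pq: "P q = (\<Sum>i\<in>S. (h i q * g q (E k q) (F i q)) *\<^sub>R F i q)" for q
    by (simp add: P_def sum_fun_apply fmult_def inner_product_def)
  have Gq: "G q = E k q - P q" for q by (simp add: G_def)
  note T = vector_field_tangent
  have Gx: "G q (x b) = (if b = k then 1 else 0)" if q: "q \<in> N" and b: "b \<in> Basis - S" for q b
  proof -
    have "P q (x b) = 0" using Fx[OF q _ b] by (simp add: Pq sum_fun_apply scaleR_fun_apply)
    then show ?thesis using frame_onD(4)[OF frame _ k(1), of q b] q N(3) b by (auto simp: Gq)
  qed
  have orth: "g q (G q) (F j q) = 0" "g q (F j q) (G q) = 0" if q: "q \<in> N" and j: "j \<in> S" for q j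
  proof -
    have "g q (P q) (F j q) = (\<Sum>i\<in>S. h i q * g q (E k q) (F i q) * g q (F i q) (F j q))"
      by (simp add: Pq metric_sum_left T F j tangent_space_scaleR metric_scaleR_left)
    also have "\<dots> = (\<Sum>i\<in>S. if i = j then g q (E k q) (F j q) else 0)"
      by (rule sum.cong) (use frameN[OF q] j in \<open>auto simp: orthogonal_frame_at_def\<close>)
    also have "\<dots> = g q (E k q) (F j q)" using j k(3) by simp
    finally show *: "g q (G q) (F j q) = 0"
      by (simp add: Gq metric_diff_left T F j Ek P)
    then show "g q (F j q) (G q) = 0"
      using metric_sym[OF T[OF F[OF j]] T[OF G]] by metis
  qed
  have EG: "g q (E k q) (G q) = g q (G q) (G q)" if q: "q \<in> N" for q
  proof -
    have "g q (P q) (G q) = 0"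
      by (simp add: Pq metric_sum_left T F G tangent_space_scaleR metric_scaleR_left orth[OF q])
    then show ?thesis using metric_diff_left[OF T[OF G] T[OF Ek] T[OF P], of q] by (simp add: Gq)
  qed
  have "G p \<noteq> 0" using Gx[OF N(2), of k] k by auto
  then have "inner_product G G p \<noteq> 0"
    using metric_pos[OF T[OF G, of p]] by (simp add: inner_product_def)
  then obtain r M where r: "r \<in> smooth_functions A" and M: "open M" "p \<in> M"
    and rG: "\<And>q. q \<in> M \<Longrightarrow> r q * inner_product G G q = 1"
    using local_inverse[OF inner_product_smooth[OF G G]] by metis
  let ?F = "F(k := G)" and ?h = "h(k := r)"
  have eqS: "?F i = F i" "?h i = h i" if "i \<in> S" for i using that k(2) by auto
  have "orthogonal_frame_at q (insert k S) ?F ?h" if q: "q \<in> N" "q \<in> M" for q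
    using frameN[OF q(1)] orth[OF q(1)] rG[OF q(2)] k(2)
    by (auto simp: orthogonal_frame_at_def inner_product_def)
  moreover have "?F i q (x b) = 0" if "q \<in> N" "i \<in> insert k S" "b \<in> Basis - insert k S" for q i b
    using that Fx[of q i b] Gx[of q b] by (auto simp: eqS)
  moreover have "E j q = (\<Sum>i\<in>insert k S. (?h i q * g q (E j q) (?F i q)) *\<^sub>R ?F i q)"
    if q: "q \<in> N" "q \<in> M" and j: "j \<in> insert k S" for q j
  proof -
    have "(\<Sum>i\<in>S. (?h i q * g q (E j q) (?F i q)) *\<^sub>R ?F i q) =
        (\<Sum>i\<in>S. (h i q * g q (E j q) (F i q)) *\<^sub>R F i q)"
      by (rule sum.cong) (simp_all only: eqS)
    then have "(\<Sum>i\<in>insert k S. (?h i q * g q (E j q) (?F i q)) *\<^sub>R ?F i q) =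
        (r q * g q (E j q) (G q)) *\<^sub>R G q + (\<Sum>i\<in>S. (h i q * g q (E j q) (F i q)) *\<^sub>R F i q)"
      using k(2,3) by (simp del: fun_upd_apply) simp
    also have "\<dots> = E j q"
    proof (cases "j = k")
      case True
      have "r q * g q (E k q) (G q) = 1" using EG[OF q(1)] rG[OF q(2)] by (simp add: inner_product_def)
      then show ?thesis using True by (simp add: Gq Pq)
    next
      case False
      then have j: "j \<in> S" using j by simp
      have "g q (E j q) (G q) = 0"
        by (subst EF[OF q(1) j])
          (simp add: metric_sum_left T F G tangent_space_scaleR metric_scaleR_left orth[OF q(1)])
      then show ?thesis using EF[OF q(1) j] by simp
    qed
    finally show ?thesis by simp
  qed
  moreover have "?F i \<in> vector_fields A" "?h i \<in> smooth_functions A" if "i \<in> insert k S" for i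
    using that F h G r by auto
  ultimately show ?case
    using N M by (intro exI[of _ "N \<inter> M"] exI[of _ ?F] exI[of _ ?h])
      (auto simp del: fun_upd_apply)
qed

text \<open>Expand in the frame of a chart first, and each frame vector in its orthogonalisation.\<close>

lemma orthogonal_expansion:
  obtains N F h where "open N" and "p \<in> N"
    and "\<forall>i\<in>(Basis :: 'e set). F i \<in> vector_fields A \<and> h i \<in> smooth_functions A"
    and "\<forall>q\<in>N. \<forall>v\<in>tangent_space A q.
      v = (\<Sum>i\<in>(Basis :: 'e set). (h i q * g q v (F i q)) *\<^sub>R F i q)"
proof -
  obtain W x E where W: "p \<in> W" and frame: "frame_on W x E" by (rule local_frame)
  from gram_schmidt[OF frame W finite_Basis order_refl] obtain N F h where
      N: "open N" "p \<in> N" "N \<subseteq> W"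
    and Fh: "\<forall>i\<in>Basis. F i \<in> vector_fields A \<and> h i \<in> smooth_functions A"
    and onN: "\<forall>q\<in>N. orthogonal_frame_at q Basis F h \<and>
      (\<forall>i\<in>Basis. \<forall>b\<in>Basis - Basis. F i q (x b) = 0) \<and>
      (\<forall>j\<in>Basis. E j q = (\<Sum>i\<in>Basis. (h i q * g q (E j q) (F i q)) *\<^sub>R F i q))"
    by (elim exE conjE) (rule that)
  from Fh have F: "\<And>i. i \<in> Basis \<Longrightarrow> F i \<in> vector_fields A" by blast
  from onN have EF: "\<And>q j. q \<in> N \<Longrightarrow> j \<in> Basis \<Longrightarrow>
      E j q = (\<Sum>i\<in>Basis. (h i q * g q (E j q) (F i q)) *\<^sub>R F i q)" by blast
  note T = vector_field_tangent
  have "\<forall>q\<in>N. \<forall>v\<in>tangent_space A q. v = (\<Sum>i\<in>Basis. (h i q * g q v (F i q)) *\<^sub>R F i q)"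
  proof (intro ballI)
    fix q v assume q: "q \<in> N" and v: "v \<in> tangent_space A q"
    note E = frame_onD(3)[OF frame]
    have v: "v = (\<Sum>b\<in>Basis. v (x b) *\<^sub>R E b q)"
      by (rule frame_onD(5)[OF frame _ v]) (use q N(3) in blast)
    have gv: "g q v (F i q) = (\<Sum>b\<in>Basis. v (x b) * g q (E b q) (F i q))" if "i \<in> Basis" for i
      by (subst v) (simp add: metric_sum_left T F E that tangent_space_scaleR metric_scaleR_left)
    have "v = (\<Sum>b\<in>Basis. v (x b) *\<^sub>R (\<Sum>i\<in>Basis. (h i q * g q (E b q) (F i q)) *\<^sub>R F i q))"
      using v EF[OF q] by simp
    also have "\<dots> = (\<Sum>b\<in>Basis. \<Sum>i\<in>Basis. (v (x b) * (h i q * g q (E b q) (F i q))) *\<^sub>R F i q)"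
      by (simp add: scaleR_sum_right)
    also have "\<dots> = (\<Sum>i\<in>Basis. \<Sum>b\<in>Basis. (v (x b) * (h i q * g q (E b q) (F i q))) *\<^sub>R F i q)"
      by (rule sum.swap)
    also have "\<dots> = (\<Sum>i\<in>Basis. (h i q * g q v (F i q)) *\<^sub>R F i q)"
      by (rule sum.cong) (simp_all add: gv sum_distrib_left scaleR_sum_left[symmetric] mult_ac)
    finally show "v = (\<Sum>i\<in>Basis. (h i q * g q v (F i q)) *\<^sub>R F i q)" .
  qed
  then show thesis by (rule that[OF N(1,2) Fh])
qed

text \<open>The vector \<open>\<Sum>i. h i * \<omega>(F i) * F i\<close> represents \<open>\<omega>\<close>, by expanding the argument; positivity of the
  metric makes it unique.\<close>

lemma sharp_at:
  assumes \<omega>: "linear_on (tangent_space A p) (\<omega> p)"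
  shows "sharp A g \<omega> p \<in> tangent_space A p"
    and "\<And>w. w \<in> tangent_space A p \<Longrightarrow> g p (sharp A g \<omega> p) w = \<omega> p w"
proof -
  obtain N F h where N: "open N" "p \<in> N" and Fh: "\<forall>i\<in>(Basis :: 'e set). F i \<in> vector_fields A \<and> h i \<in> smooth_functions A"
    and expand: "\<forall>q\<in>N. \<forall>v\<in>tangent_space A q.
      v = (\<Sum>i\<in>(Basis :: 'e set). (h i q * g q v (F i q)) *\<^sub>R F i q)"
    by (rule orthogonal_expansion[of p])
  from Fh have F: "\<And>i. i \<in> Basis \<Longrightarrow> F i \<in> vector_fields A" by blast
  note T = vector_field_tangent
  let ?P = "\<lambda>v. v \<in> tangent_space A p \<and> (\<forall>w\<in>tangent_space A p. g p v w = \<omega> p w)"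
  let ?v = "\<Sum>i\<in>(Basis :: 'e set). (h i p * \<omega> p (F i p)) *\<^sub>R F i p"
  have add: "\<omega> p (u + w) = \<omega> p u + \<omega> p w" and scale: "\<omega> p (c *\<^sub>R u) = c * \<omega> p u"
    if "u \<in> tangent_space A p" "w \<in> tangent_space A p" for u w c
    using \<omega> that by (auto simp: linear_on_def)
  have \<omega>0: "\<omega> p 0 = 0"
    using scale[OF tangent_space_zero tangent_space_zero, of 0] by simp
  have \<omega>sum: "\<omega> p (\<Sum>i\<in>I. w i) = (\<Sum>i\<in>I. \<omega> p (w i))"
    if "\<And>i. i \<in> I \<Longrightarrow> w i \<in> tangent_space A p" for I :: "'e set" and w
    using that by (induction I rule: infinite_finite_induct) (auto simp: \<omega>0 add tangent_space_sum)
  have v: "?v \<in> tangent_space A p" by (intro tangent_space_sum tangent_space_scaleR T F)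
  have "g p ?v w = \<omega> p w" if w: "w \<in> tangent_space A p" for w
  proof -
    have "g p ?v w = (\<Sum>i\<in>Basis. h i p * \<omega> p (F i p) * g p (F i p) w)"
      by (simp add: metric_sum_left w T F tangent_space_scaleR metric_scaleR_left)
    also have "\<dots> = (\<Sum>i\<in>Basis. h i p * g p w (F i p) * \<omega> p (F i p))"
      by (rule sum.cong) (simp_all add: metric_sym[OF w T[OF F]])
    also have "\<dots> = \<omega> p (\<Sum>i\<in>(Basis :: 'e set). (h i p * g p w (F i p)) *\<^sub>R F i p)"
      by (simp add: \<omega>sum scale[OF T[OF F] w] tangent_space_scaleR T F)
    also have "\<dots> = \<omega> p w" using bspec[OF bspec[OF expand N(2)] w] by simp
    finally show ?thesis .
  qed
  with v have "?P ?v" by blast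
  moreover have "u = ?v" if "?P u" for u
    by (rule metric_nondegenerate[of _ p]) (use that calculation in auto)
  ultimately have "?P (sharp A g \<omega> p)" unfolding sharp_def by (rule theI)
  then show "sharp A g \<omega> p \<in> tangent_space A p"
    and "\<And>w. w \<in> tangent_space A p \<Longrightarrow> g p (sharp A g \<omega> p) w = \<omega> p w"
    by blast+
qed

text \<open>The orthogonal expansion of \<open>\<sharp>\<omega>\<close> has coefficients \<open>h i * \<omega>(F i)\<close>, which are smooth.\<close>

lemma sharp_vector_field:
  assumes \<omega>: "\<omega> \<in> one_forms A"
  shows "sharp A g \<omega> \<in> vector_fields A"
  unfolding vector_fields_def
proof (intro CollectI conjI allI ballI)
  show tangent: "sharp A g \<omega> p \<in> tangent_space A p" for p
    by (rule sharp_at[OF one_form_linear[OF \<omega>]])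
  fix f assume f: "f \<in> smooth_functions A"
  show "field_deriv (sharp A g \<omega>) f \<in> smooth_functions A"
  proof (rule smooth_functions_if_locally_eq)
    fix p
    obtain N F h where N: "open N" "p \<in> N" and Fh: "\<forall>i\<in>(Basis :: 'e set). F i \<in> vector_fields A \<and> h i \<in> smooth_functions A"
      and expand: "\<forall>q\<in>N. \<forall>v\<in>tangent_space A q.
        v = (\<Sum>i\<in>(Basis :: 'e set). (h i q * g q v (F i q)) *\<^sub>R F i q)"
      by (rule orthogonal_expansion[of p])
    from Fh have F: "\<And>i. i \<in> Basis \<Longrightarrow> F i \<in> vector_fields A"
      and h: "\<And>i. i \<in> Basis \<Longrightarrow> h i \<in> smooth_functions A" by blast+
    define V where "V = (\<Sum>i\<in>(Basis :: 'e set). fmult (h i * form_app \<omega> (F i)) (F i))"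
    have "V \<in> vector_fields A"
      unfolding V_def
      by (intro vector_fields_sum vector_fields_fmult smooth_functions_mult one_form_smooth \<omega> F h)
    moreover have "sharp A g \<omega> q = V q" if "q \<in> N" for q
      by (subst bspec[OF bspec[OF expand that] tangent])
        (simp add: V_def sum_fun_apply fmult_def form_app_def
          sharp_at(2)[OF one_form_linear[OF \<omega>]] vector_field_tangent F cong: sum.cong)
    ultimately show "\<exists>N h. open N \<and> p \<in> N \<and> h \<in> smooth_functions A \<and>
        (\<forall>q\<in>N. field_deriv (sharp A g \<omega>) f q = h q)"
      using N f by (intro exI[of _ N] exI[of _ "field_deriv V f"])
        (simp add: vector_field_deriv, simp add: field_deriv_def)
  qed
qed

lemma inner_product_sharp:
  "\<omega> \<in> one_forms A \<Longrightarrow> Z \<in> vector_fields A \<Longrightarrow> inner_product (sharp A g \<omega>) Z = form_app \<omega> Z"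
  by (simp add: inner_product_def form_app_def fun_eq_iff sharp_at(2)[OF one_form_linear]
      vector_field_tangent)

lemma form_app_flat: "Z \<in> vector_fields A \<Longrightarrow> form_app (flat A g X) Z = inner_product X Z"
  by (simp add: form_app_def flat_def inner_product_def vector_field_tangent)

lemma flat_one_form:
  assumes X: "X \<in> vector_fields A"
  shows "flat A g X \<in> one_forms A"
  unfolding one_forms_def
  using metric_linear[OF vector_field_tangent[OF X]]
  by (auto simp: form_app_flat inner_product_smooth X)
    (auto simp: flat_def linear_on_def tangent_space_add tangent_space_scaleR)

end


section \<open>The bracket of an almost Hermitian manifold\<close>

context riemannian_manifold
begin

text \<open>Lets identities between the fields obtained by \<^const>\<open>sharp\<close> be checked on the underlying
  forms.\<close>

lemma inner_product_eqI:
  assumes V: "V \<in> vector_fields A" and W: "W \<in> vector_fields A"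
    and eq: "\<And>Z. Z \<in> vector_fields A \<Longrightarrow> inner_product V Z = inner_product W Z"
  shows "V = W"
proof
  fix p
  show "V p = W p"
  proof (rule metric_nondegenerate[OF vector_field_tangent[OF V] vector_field_tangent[OF W]])
    fix u assume "u \<in> tangent_space A p"
    then obtain Z where Z: "Z \<in> vector_fields A" "Z p = u" by (rule extend_tangent_vector)
    then show "g p (V p) u = g p (W p) u"
      using fun_cong[OF eq[OF Z(1)], of p] by (simp add: inner_product_def)
  qed
qed

lemma inner_product_commute:
  "X \<in> vector_fields A \<Longrightarrow> Y \<in> vector_fields A \<Longrightarrow> inner_product X Y = inner_product Y X"
  by (simp add: inner_product_def fun_eq_iff metric_sym vector_field_tangent)

lemma inner_product_add_left:
  "X \<in> vector_fields A \<Longrightarrow> Y \<in> vector_fields A \<Longrightarrow> Z \<in> vector_fields A \<Longrightarrow>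
    inner_product (X + Y) Z = inner_product X Z + inner_product Y Z"
  by (simp add: inner_product_def fun_eq_iff metric_add_left vector_field_tangent)

lemma inner_product_fmult_left:
  "X \<in> vector_fields A \<Longrightarrow> Z \<in> vector_fields A \<Longrightarrow>
    inner_product (fmult f X) Z = f * inner_product X Z"
  by (simp add: inner_product_def fmult_def fun_eq_iff metric_scaleR_left vector_field_tangent)

lemma inner_product_add_right:
  "X \<in> vector_fields A \<Longrightarrow> Y \<in> vector_fields A \<Longrightarrow> Z \<in> vector_fields A \<Longrightarrow>
    inner_product Z (X + Y) = inner_product Z X + inner_product Z Y"
  by (simp add: inner_product_def fun_eq_iff metric_add_right vector_field_tangent)

lemma inner_product_fmult_right:
  "X \<in> vector_fields A \<Longrightarrow> Z \<in> vector_fields A \<Longrightarrow>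
    inner_product Z (fmult f X) = f * inner_product Z X"
  by (simp add: inner_product_def fmult_def fun_eq_iff metric_scaleR_right vector_field_tangent)

lemma inner_product_diff_right:
  "X \<in> vector_fields A \<Longrightarrow> Y \<in> vector_fields A \<Longrightarrow> Z \<in> vector_fields A \<Longrightarrow>
    inner_product Z (X - Y) = inner_product Z X - inner_product Z Y"
  using inner_product_add_right[of "X - Y" Y Z] by (simp add: vector_fields_diff)

text \<open>The Lie derivative along \<open>X\<close> of the form \<open>Y\<^sup>\<flat>\<close>, evaluated on \<open>Z\<close>.\<close>

definition lie_flat :: "'m field \<Rightarrow> 'm field \<Rightarrow> 'm field \<Rightarrow> 'm \<Rightarrow> real"
  where "lie_flat X Y Z = field_deriv X (inner_product Y Z) - inner_product Y (lie_bracket X Z)"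

lemma form_app_lie_deriv_flat:
  assumes "X \<in> vector_fields A" and "Y \<in> vector_fields A" and "Z \<in> vector_fields A"
  shows "form_app (lie_deriv A X (flat A g Y)) Z = lie_flat X Y Z"
  using assms by (simp add: lie_deriv(2) flat_one_form form_app_flat lie_flat_def
      vector_fields_lie_bracket)

lemma lie_flat_add_left:
  "X \<in> vector_fields A \<Longrightarrow> X' \<in> vector_fields A \<Longrightarrow> Y \<in> vector_fields A \<Longrightarrow> Z \<in> vector_fields A \<Longrightarrow>
    lie_flat (X + X') Y Z = lie_flat X Y Z + lie_flat X' Y Z"
  by (simp add: lie_flat_def field_deriv_field_add lie_bracket_add_left inner_product_add_right
      vector_fields_lie_bracket)

lemma lie_flat_add_right:
  "X \<in> vector_fields A \<Longrightarrow> Y \<in> vector_fields A \<Longrightarrow> Y' \<in> vector_fields A \<Longrightarrow> Z \<in> vector_fields A \<Longrightarrow>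
    lie_flat X (Y + Y') Z = lie_flat X Y Z + lie_flat X Y' Z"
  by (simp add: lie_flat_def field_deriv_add inner_product_add_left inner_product_smooth
      vector_fields_lie_bracket)

text \<open>The error term is the product of the differential of \<open>f\<close> with \<open>g(Y, X)\<close>; it comes from
  \<open>[fX, Z] = f [X, Z] - Z(f) X\<close>.\<close>

lemma lie_flat_fmult_left:
  "X \<in> vector_fields A \<Longrightarrow> Y \<in> vector_fields A \<Longrightarrow> Z \<in> vector_fields A \<Longrightarrow> f \<in> smooth_functions A \<Longrightarrow>
    lie_flat (fmult f X) Y Z = f * lie_flat X Y Z + field_deriv Z f * inner_product Y X"
  by (simp add: lie_flat_def field_deriv_fmult lie_bracket_fmult_left inner_product_diff_right
      inner_product_fmult_right vector_fields_lie_bracket vector_fields_fmult vector_field_deriv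
      algebra_simps)

lemma lie_flat_fmult_right:
  "X \<in> vector_fields A \<Longrightarrow> Y \<in> vector_fields A \<Longrightarrow> Z \<in> vector_fields A \<Longrightarrow> f \<in> smooth_functions A \<Longrightarrow>
    lie_flat X (fmult f Y) Z = f * lie_flat X Y Z + field_deriv X f * inner_product Y Z"
  by (simp add: lie_flat_def field_deriv_mult inner_product_fmult_left inner_product_smooth
      vector_fields_lie_bracket algebra_simps)

end

context almost_hermitian_manifold
begin

abbreviation JF :: "'m field \<Rightarrow> 'm field"
  where "JF \<equiv> apply_endo J"

lemma J_add:
  "v \<in> tangent_space A p \<Longrightarrow> w \<in> tangent_space A p \<Longrightarrow> J p (v + w) = J p v + J p w"
  using J_linear[of p] by (simp add: linear_on_def)

lemma J_scaleR: "v \<in> tangent_space A p \<Longrightarrow> J p (c *\<^sub>R v) = c *\<^sub>R J p v"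
  using J_linear[of p] by (simp add: linear_on_def)

lemma JF_add: "X \<in> vector_fields A \<Longrightarrow> Y \<in> vector_fields A \<Longrightarrow> JF (X + Y) = JF X + JF Y"
  by (simp add: apply_endo_def fun_eq_iff J_add vector_field_tangent)

lemma JF_fmult: "X \<in> vector_fields A \<Longrightarrow> JF (fmult f X) = fmult f (JF X)"
  by (simp add: apply_endo_def fmult_def fun_eq_iff J_scaleR vector_field_tangent)

lemma JF_JF: "X \<in> vector_fields A \<Longrightarrow> JF (JF X) = (-1) *\<^sub>R X"
  by (simp add: apply_endo_def fun_eq_iff J_square vector_field_tangent scaleR_fun_apply)

text \<open>Since \<open>J\<close> is orthogonal with square \<open>-1\<close>, it is skew-adjoint.\<close>

lemma inner_product_JF_skew:
  assumes X: "X \<in> vector_fields A" and Y: "Y \<in> vector_fields A"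
  shows "inner_product (JF X) Y + inner_product (JF Y) X = 0"
proof
  fix p
  note T = vector_field_tangent[of _ p]
  have "g p (J p (X p)) (Y p) = g p (J p (J p (X p))) (J p (Y p))"
    by (rule J_orthogonal[OF J_tangent[OF T[OF X]] T[OF Y], symmetric])
  also have "\<dots> = g p ((-1) *\<^sub>R X p) (J p (Y p))"
    by (simp add: J_square[OF T[OF X]])
  also have "\<dots> = - g p (X p) (J p (Y p))"
    using metric_scaleR_left[OF J_tangent[OF T[OF Y]] T[OF X], of "-1"] by simp
  also have "g p (X p) (J p (Y p)) = g p (J p (Y p)) (X p)"
    by (rule metric_sym[OF T[OF X] J_tangent[OF T[OF Y]]])
  finally show "(inner_product (JF X) Y + inner_product (JF Y) X) p = 0 p"
    by (simp add: inner_product_def apply_endo_def)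
qed

definition lie_part :: "'m field \<Rightarrow> 'm field \<Rightarrow> 'm field"
  where "lie_part X Y = lie_bracket X (JF Y) + lie_bracket Y (JF X)"

definition form_part :: "'m field \<Rightarrow> 'm field \<Rightarrow> 'm form"
  where "form_part X Y =
    lie_deriv A X (flat A g (JF Y)) + lie_deriv A Y (flat A g (JF X)) +
    lie_deriv A (JF X) (flat A g Y) + lie_deriv A (JF Y) (flat A g X)"

lemma hermitian_bracket_eq:
  "hermitian_bracket A g J X Y = (-1/2) *\<^sub>R JF (lie_part X Y + sharp A g (form_part X Y))"
  by (simp add: hermitian_bracket_def lie_part_def form_part_def Let_def)

lemma lie_part_field: "X \<in> vector_fields A \<Longrightarrow> Y \<in> vector_fields A \<Longrightarrow> lie_part X Y \<in> vector_fields A"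
  by (simp add: lie_part_def vector_fields_add vector_fields_lie_bracket J_smooth)

lemma lie_part_commute: "lie_part X Y = lie_part Y X"
  by (simp add: lie_part_def add.commute)

lemma lie_part_add:
  assumes "X \<in> vector_fields A" and "Y \<in> vector_fields A" and "Z \<in> vector_fields A"
  shows "lie_part X (Y + Z) = lie_part X Y + lie_part X Z"
  using assms by (simp add: lie_part_def JF_add lie_bracket_add_left lie_bracket_add_right J_smooth)

lemma lie_part_fmult:
  assumes "X \<in> vector_fields A" and "Y \<in> vector_fields A" and "f \<in> smooth_functions A"
  shows "lie_part X (fmult f Y) =
    fmult f (lie_part X Y) + fmult (field_deriv X f) (JF Y) - fmult (field_deriv (JF X) f) Y"
  using assms
  by (simp add: lie_part_def JF_fmult lie_bracket_fmult_left lie_bracket_fmult_right J_smooth)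
    (simp add: fmult_def fun_eq_iff scaleR_fun_apply algebra_simps)

lemma form_part_one_form:
  "X \<in> vector_fields A \<Longrightarrow> Y \<in> vector_fields A \<Longrightarrow> form_part X Y \<in> one_forms A"
  by (simp add: form_part_def one_forms_add lie_deriv(1) flat_one_form J_smooth)

lemma form_part_commute: "form_part X Y = form_part Y X"
  by (simp add: form_part_def add_ac)

lemma form_part_field:
  "X \<in> vector_fields A \<Longrightarrow> Y \<in> vector_fields A \<Longrightarrow> sharp A g (form_part X Y) \<in> vector_fields A"
  by (intro sharp_vector_field form_part_one_form)

lemma inner_product_form_part:
  assumes "X \<in> vector_fields A" and "Y \<in> vector_fields A" and "Z \<in> vector_fields A"
  shows "inner_product (sharp A g (form_part X Y)) Z =
    lie_flat X (JF Y) Z + lie_flat Y (JF X) Z + lie_flat (JF X) Y Z + lie_flat (JF Y) X Z"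
proof -
  have "form_app (\<omega> + \<eta>) Z = form_app \<omega> Z + form_app \<eta> Z" for \<omega> \<eta> :: "'m form"
    by (simp add: form_app_def fun_eq_iff)
  then have "form_app (form_part X Y) Z =
      lie_flat X (JF Y) Z + lie_flat Y (JF X) Z + lie_flat (JF X) Y Z + lie_flat (JF Y) X Z"
    using assms by (simp add: form_part_def form_app_lie_deriv_flat J_smooth)
  then show ?thesis
    using assms by (simp add: inner_product_sharp form_part_one_form)
qed

lemma sharp_form_part_add:
  assumes X: "X \<in> vector_fields A" and Y: "Y \<in> vector_fields A" and Z: "Z \<in> vector_fields A"
  shows "sharp A g (form_part X (Y + Z)) = sharp A g (form_part X Y) + sharp A g (form_part X Z)"
  by (rule inner_product_eqI)
    (simp_all add: X Y Z form_part_field vector_fields_add inner_product_add_left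
      inner_product_form_part JF_add J_smooth lie_flat_add_left lie_flat_add_right algebra_simps)

text \<open>Replacing \<open>Y\<close> by \<open>fY\<close> produces four error terms. Those of the Lie derivatives along \<open>X\<close> and \<open>JX\<close>
  remain; those of the Lie derivatives along \<open>Y\<close> and \<open>JY\<close> are the differential of \<open>f\<close> multiplied by
  \<open>g(JX, Y)\<close> and \<open>g(X, JY)\<close>, and these cancel.\<close>

lemma sharp_form_part_fmult:
  assumes X: "X \<in> vector_fields A" and Y: "Y \<in> vector_fields A" and f: "f \<in> smooth_functions A"
  shows "sharp A g (form_part X (fmult f Y)) =
    fmult f (sharp A g (form_part X Y)) + fmult (field_deriv X f) (JF Y) + fmult (field_deriv (JF X) f) Y"
    (is "?L = ?R")
proof (rule inner_product_eqI)
  show "?L \<in> vector_fields A" "?R \<in> vector_fields A"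
    using X Y f by (simp_all add: form_part_field vector_fields_add vector_fields_fmult J_smooth
        vector_field_deriv)
  fix Z assume Z: "Z \<in> vector_fields A"
  have "inner_product ?L Z = inner_product ?R Z +
      field_deriv Z f * (inner_product (JF X) Y + inner_product X (JF Y))"
    using X Y Z f
    by (simp add: form_part_field vector_fields_add vector_fields_fmult J_smooth
        vector_field_deriv inner_product_form_part JF_fmult lie_flat_fmult_left lie_flat_fmult_right
        inner_product_add_left inner_product_fmult_left algebra_simps)
  moreover have "inner_product (JF X) Y + inner_product X (JF Y) = 0"
    using inner_product_JF_skew[OF X Y] inner_product_commute[OF X J_smooth[OF Y]] by simp
  ultimately show "inner_product ?L Z = inner_product ?R Z" by simp
qed

lemma hermitian_bracket_field:
  "X \<in> vector_fields A \<Longrightarrow> Y \<in> vector_fields A \<Longrightarrow> hermitian_bracket A g J X Y \<in> vector_fields A"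
  unfolding hermitian_bracket_eq
  by (intro vector_fields_scaleR J_smooth vector_fields_add lie_part_field form_part_field)

lemma hermitian_bracket_commute: "hermitian_bracket A g J X Y = hermitian_bracket A g J Y X"
  by (simp add: hermitian_bracket_eq lie_part_commute[of X] form_part_commute[of X])

lemma hermitian_bracket_add:
  assumes "X \<in> vector_fields A" and "Y \<in> vector_fields A" and "Z \<in> vector_fields A"
  shows "hermitian_bracket A g J X (Y + Z) = hermitian_bracket A g J X Y + hermitian_bracket A g J X Z"
  using assms
  by (simp add: hermitian_bracket_eq lie_part_add sharp_form_part_add JF_add lie_part_field
      form_part_field vector_fields_add scaleR_add_right)

text \<open>The errors \<open>-JX(f) Y\<close> of the Lie brackets and \<open>JX(f) Y\<close> of the forms cancel, while both parts
  contribute \<open>X(f) JY\<close>. The factor \<open>-1/2\<close> and \<open>J\<^sup>2 = -1\<close> turn \<open>2 X(f) JY\<close> into \<open>X(f) Y\<close>.\<close>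

lemma hermitian_bracket_fmult:
  assumes X: "X \<in> vector_fields A" and Y: "Y \<in> vector_fields A" and f: "f \<in> smooth_functions A"
  shows "hermitian_bracket A g J X (fmult f Y) =
    fmult f (hermitian_bracket A g J X Y) + fmult (field_deriv X f) Y"
proof -
  let ?T = "lie_part X Y + sharp A g (form_part X Y)"
  have T: "?T \<in> vector_fields A"
    using X Y by (intro vector_fields_add lie_part_field form_part_field)
  have eq: "lie_part X (fmult f Y) + sharp A g (form_part X (fmult f Y)) =
      fmult f ?T + fmult (2 * field_deriv X f) (JF Y)"
    using X Y f
    by (simp add: lie_part_fmult sharp_form_part_fmult)
      (simp add: fmult_def fun_eq_iff scaleR_fun_apply algebra_simps)
  have "JF (fmult f ?T + fmult (2 * field_deriv X f) (JF Y)) =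
      fmult f (JF ?T) + fmult (2 * field_deriv X f) ((-1) *\<^sub>R Y)"
    using T Y f vector_field_deriv[OF X f] smooth_functions_const[of 2]
    by (simp add: JF_add JF_fmult JF_JF J_smooth vector_fields_fmult smooth_functions_mult
        numeral_fun)
  then show ?thesis
    unfolding hermitian_bracket_eq eq
    by (simp add: fmult_def fun_eq_iff scaleR_fun_apply algebra_simps)
qed

text \<open>The Leibniz rule with a constant function, whose derivative vanishes.\<close>

lemma hermitian_bracket_scaleR:
  assumes "X \<in> vector_fields A" and "Y \<in> vector_fields A"
  shows "hermitian_bracket A g J X (c *\<^sub>R Y) = c *\<^sub>R hermitian_bracket A g J X Y"
proof -
  have "fmult 0 Y = 0" by (simp add: fmult_def fun_eq_iff)
  then show ?thesis
    using hermitian_bracket_fmult[OF assms smooth_functions_const[of c]] assms(1)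
    by (simp add: fmult_const field_deriv_const)
qed

lemma symmetric_bracket_hermitian_bracket: "symmetric_bracket A (hermitian_bracket A g J)"
proof -
  have lin: "linear_on (vector_fields A) (hermitian_bracket A g J X)" if "X \<in> vector_fields A" for X
    using that by (simp add: linear_on_def hermitian_bracket_add hermitian_bracket_scaleR)
  then have "linear_on (vector_fields A) (\<lambda>X. hermitian_bracket A g J X Y)"
    if "Y \<in> vector_fields A" for Y
    using that by (subst hermitian_bracket_commute)
  with lin show ?thesis
    unfolding symmetric_bracket_def
    by (intro conjI ballI hermitian_bracket_commute hermitian_bracket_field hermitian_bracket_fmult)
qed

end

theorem corollary6p4:
  fixes A :: "('m::{t2_space, second_countable_topology}, 'e::euclidean_space) chart set"
    and g :: "'m \<Rightarrow> 'm tangent \<Rightarrow> 'm tangent \<Rightarrow> real"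
    and J :: "'m \<Rightarrow> 'm tangent \<Rightarrow> 'm tangent"
    and n :: nat
  assumes "almost_hermitian_manifold A g J n"
  shows "symmetric_bracket A (hermitian_bracket A g J)"
  by (rule almost_hermitian_manifold.symmetric_bracket_hermitian_bracket[OF assms])

end
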